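(* Let $\lambda$ be a (nonzero) limit ordinal. There exists no countable subshift of finite type $\mathbf{X}\subseteq\Sigma^{\mathbb{Z}^2}$ (over any finite alphabet $\Sigma$) of Cantor-Bendixson rank $\lambda+2$.
   Context: A configuration is an element of $\Sigma^{\mathbb{Z}^2}$, $\Sigma$ finite. A pattern is an element $P\in\Sigma^V$ with $V\subset\mathbb{Z}^2$ finite; it appears in $c$ if there is $v\in\mathbb{Z}^2$ with $c(a+v)=P(a)$ for all $a\in V$. A subshift of finite type (SFT) is the set of all configurations in which no pattern of a given finite set of patterns appears. $\Sigma^{\mathbb{Z}^2}$ carries the product topology of the discrete topology. The topological derivative $\mathbf{X}'$ is the set of points of $\mathbf{X}$ not isolated in $\mathbf{X}$; $\mathbf{X}^{(0)}=\mathbf{X}$, $\mathbf{X}^{(\alpha+1)}=(\mathbf{X}^{(\alpha)})'$, and $\mathbf{X}^{(\mu)}=\bigcap_{\alpha<\mu}\mathbf{X}^{(\alpha)}$ for limit $\mu$. The Cantor-Bendixson rank of $\mathbf{X}$ is the smallest ordinal $\beta$ such that $\mathbf{X}^{(\beta)}=\mathbf{X}^{(\beta+1)}$ (for countable $\mathbf{X}$, this is the smallest $\beta$ with $\mathbf{X}^{(\beta)}=\emptyset$). *)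

theory Defs
  imports
    "HOL-Analysis.Function_Topology"
    "HOL-Algebra.Free_Abelian_Groups" (* for the ordinal recursion of HOL-Cardinals *)
begin

section \<open>Configurations, patterns and subshifts of finite type\<close>

definition configurations :: "'a set \<Rightarrow> (int \<times> int \<Rightarrow> 'a) set" where
  "configurations \<Sigma> = {c. range c \<subseteq> \<Sigma>}"

definition config_topology :: "'a set \<Rightarrow> (int \<times> int \<Rightarrow> 'a) topology" where
  "config_topology \<Sigma> = product_topology (\<lambda>_. discrete_topology \<Sigma>) UNIV"

lemma topspace_config_topology: "topspace (config_topology \<Sigma>) = configurations \<Sigma>"
  by (auto simp: config_topology_def configurations_def PiE_iff)

text \<open>A pattern \<open>P \<in> \<Sigma>\<^sup>V\<close> is a partial map whose domain is the finite support \<open>V\<close>.\<close>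

definition patterns :: "'a set \<Rightarrow> (int \<times> int \<rightharpoonup> 'a) set" where
  "patterns \<Sigma> = {P. finite (dom P) \<and> ran P \<subseteq> \<Sigma>}"

definition appears_in :: "(int \<times> int \<rightharpoonup> 'a) \<Rightarrow> (int \<times> int \<Rightarrow> 'a) \<Rightarrow> bool" where
  "appears_in P c \<longleftrightarrow> (\<exists>v. \<forall>a \<in> dom P. P a = Some (c (a + v)))"

definition is_SFT :: "'a set \<Rightarrow> (int \<times> int \<Rightarrow> 'a) set \<Rightarrow> bool" where
  "is_SFT \<Sigma> X \<longleftrightarrow>
     (\<exists>F. finite F \<and> F \<subseteq> patterns \<Sigma> \<and>
          X = {c \<in> configurations \<Sigma>. \<forall>P \<in> F. \<not> appears_in P c})"

section \<open>Cantor--Bendixson derivatives and rank\<close>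

definition top_derivative :: "'b topology \<Rightarrow> 'b set \<Rightarrow> 'b set" where
  "top_derivative T X = X \<inter> T derived_set_of X"

lemma top_derivative_eq_not_isolated:
  assumes "X \<subseteq> topspace T"
  shows "top_derivative T X = {x \<in> X. \<not> openin (subtopology T X) {x}}"
proof -
  have "x \<in> T derived_set_of X \<longleftrightarrow> \<not> openin (subtopology T X) {x}" if "x \<in> X" for x
  proof -
    have "openin (subtopology T X) {x} \<longleftrightarrow> (\<exists>U. openin T U \<and> U \<inter> X = {x})"
      by (auto simp: openin_subtopology)
    also have "\<dots> \<longleftrightarrow> (\<exists>U. x \<in> U \<and> openin T U \<and> (\<forall>y. y \<noteq> x \<longrightarrow> y \<in> X \<longrightarrow> y \<notin> U))"
      using that by blast
    finally show ?thesis
      using that assms by (auto simp: derived_set_of_def)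
  qed
  then show ?thesis
    by (auto simp: top_derivative_def)
qed

text \<open>
  Ordinals are elements of the field of a well-order \<open>r\<close>, each standing for the order type of
  its strict initial segment. The three arguments of the recursion are the clauses for
  \<open>X\<^sup>(\<^sup>0\<^sup>)\<close>, for successors and for nonzero limits, see the lemmas below.
\<close>

definition cb_derivative :: "'o rel \<Rightarrow> 'b topology \<Rightarrow> 'b set \<Rightarrow> 'o \<Rightarrow> 'b set" where
  "cb_derivative r T X =
     wo_rel.worecZSL r X (\<lambda>_. top_derivative T) (\<lambda>D \<mu>. \<Inter>\<alpha> \<in> underS r \<mu>. D \<alpha>)"

lemma
  assumes "Well_order r"
  shows cb_derivative_zero: "cb_derivative r T X (wo_rel.zero r) = X"
    and cb_derivative_succ: "aboveS r \<alpha> \<noteq> {} \<Longrightarrow>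
      cb_derivative r T X (wo_rel.succ r \<alpha>) = top_derivative T (cb_derivative r T X \<alpha>)"
    and cb_derivative_lim: "wo_rel.isLim r \<mu> \<Longrightarrow> \<mu> \<noteq> wo_rel.zero r \<Longrightarrow>
      cb_derivative r T X \<mu> = (\<Inter>\<alpha> \<in> underS r \<mu>. cb_derivative r T X \<alpha>)"
proof -
  interpret wo_rel r by (rule wo_rel.intro) fact
  have adm: "adm_woL (\<lambda>D \<mu>. \<Inter>\<alpha> \<in> underS \<mu>. D \<alpha>)"
    by (auto simp: adm_woL_def)
  show "cb_derivative r T X zero = X"
    unfolding cb_derivative_def by (rule worecZSL_zero[OF adm])
  show "cb_derivative r T X (succ \<alpha>) = top_derivative T (cb_derivative r T X \<alpha>)"
    if "aboveS \<alpha> \<noteq> {}"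
    unfolding cb_derivative_def by (rule worecZSL_succ[OF adm that])
  show "cb_derivative r T X \<mu> = (\<Inter>\<alpha> \<in> underS \<mu>. cb_derivative r T X \<alpha>)"
    if "isLim \<mu>" "\<mu> \<noteq> zero"
    unfolding cb_derivative_def by (rule worecZSL_isLim[OF adm that])
qed

text \<open>Meant for well-orders \<open>r\<close> without a last element, where every \<open>\<beta>\<close> has a successor.\<close>

definition has_cb_rank :: "'o rel \<Rightarrow> 'b topology \<Rightarrow> 'b set \<Rightarrow> 'o \<Rightarrow> bool" where
  "has_cb_rank r T X \<beta> \<longleftrightarrow>
     wo_rel.isMinim r
       {\<beta> \<in> Field r. cb_derivative r T X \<beta> = cb_derivative r T X (wo_rel.succ r \<beta>)} \<beta>"

end

theory Submission
  imports Defs "HOL-Analysis.Urysohn"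
begin

text \<open>
  Suppose that \<open>X\<close> is a countable subshift of finite type of rank \<open>\<lambda> + 2\<close>, and write
  \<open>Z = X\<^sup>(\<^sup>\<lambda>\<^sup>)\<close> and \<open>F = X\<^sup>(\<^sup>\<lambda>\<^sup>+\<^sup>1\<^sup>)\<close>. A countable closed set that equals its derivative
  is empty, so \<open>X\<^sup>(\<^sup>\<lambda>\<^sup>+\<^sup>2\<^sup>) = \<emptyset>\<close> and by compactness \<open>F\<close> is finite; its members are therefore
  periodic under \<open>(N, 0)\<close> and \<open>(0, N)\<close> for a common \<open>N\<close>.

  Say that \<open>z\<close> has a defect at a cell \<open>v\<close> if \<open>z\<close> changes between \<open>v\<close> and \<open>v + s\<close> for one of
  finitely many given vectors \<open>s\<close> whose coordinates are multiples of \<open>N\<close>; at first \<open>s\<close> is \<open>(N, 0)\<close> or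
  \<open>(0, N)\<close>. Members of \<open>F\<close> have no defect, so the members of \<open>Z\<close> with a defect at the
  origin form a closed set of isolated points of \<open>Z\<close>, which is finite. If such a configuration \<open>x\<close>
  had no period at all, then the translates of \<open>x\<close> that move one of its defects to the origin would
  be distinct, so that \<open>x\<close> would have finitely many defects and would be a finite perturbation of a
  doubly periodic configuration. As \<open>X\<close> is determined by local constraints, this perturbation could
  be inserted independently at the points of a coarse lattice, and \<open>X\<close> would be uncountable
  (lemma \<open>uncountable_if_finite_perturbation\<close>). So every member of \<open>Z\<close> with a defect has a nonzero
  period, finitely many vectors \<open>s\<close> serve for all of them, and from now on defects refer to these.

  This periodicity is a local matter (lemma \<open>local_periodicity\<close>): if every window of a
  certain size in \<open>c\<close> occurs in \<open>Z\<close>, then the defects of \<open>c\<close> come in lines, and two lines in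
  different directions would come close to each other, which no member of \<open>Z\<close> shows. Hence all
  lines in \<open>c\<close> have the same direction, and \<open>c\<close> has one of the periods \<open>s\<close>. Now \<open>\<lambda>\<close> is a limit, so
  \<open>Z\<close> is the intersection of the decreasing closed sets \<open>X\<^sup>(\<^sup>\<alpha>\<^sup>)\<close> for \<open>\<alpha> < \<lambda>\<close>, and by compactness
  some \<open>X\<^sup>(\<^sup>\<alpha>\<^sup>)\<close> shows only windows of \<open>Z\<close>. It is contained in the union of the finitely many sets
  \<open>{c \<in> X. shift s c = c}\<close>.

  For fixed \<open>s\<close>, such a set is a one-dimensional subshift of finite type in disguise: its members are
  bi-infinite walks in a finite graph. By countability no vertex has two successors
  that both lead back to it. Hence a walk is determined by any stretch of it that contains all edges
  which it cannot undo, and each such edge occurs at most once. Counting them bounds the rank by a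
  natural number
  (lemma \<open>periodic_configurations_finite_rank\<close>). Therefore \<open>X\<^sup>(\<^sup>\<alpha>\<^sup>+\<^sup>n\<^sup>)\<close> is empty for some natural
  \<open>n\<close>. But \<open>\<alpha> + n < \<lambda>\<close>, so \<open>Z\<close> is empty, and the rank is at most \<open>\<lambda>\<close>.
\<close>

section \<open>Configurations, shifts and derivatives\<close>

\<comment> \<open>Cells are used as vectors, so quantifiers over cells are not split into coordinates.\<close>
declare split_paired_All [simp del] split_paired_Ex [simp del]

definition shift :: "int \<times> int \<Rightarrow> (int \<times> int \<Rightarrow> 'a) \<Rightarrow> int \<times> int \<Rightarrow> 'a" where
  "shift u c = (\<lambda>v. c (u + v))"

definition shift_invariant :: "(int \<times> int \<Rightarrow> 'a) set \<Rightarrow> bool" where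
  "shift_invariant A \<longleftrightarrow> (\<forall>c\<in>A. \<forall>u. shift u c \<in> A)"

definition agree :: "(int \<times> int) set \<Rightarrow> (int \<times> int \<Rightarrow> 'a) \<Rightarrow> (int \<times> int \<Rightarrow> 'a) \<Rightarrow> bool" where
  "agree D c c' \<longleftrightarrow> (\<forall>d\<in>D. c d = c' d)"

definition square :: "int \<Rightarrow> (int \<times> int) set" where
  "square r = {-r..r} \<times> {-r..r}"

lemma finite_square [simp]: "finite (square r)"
  by (simp add: square_def)

lemma in_square: "v \<in> square r \<longleftrightarrow> \<bar>fst v\<bar> \<le> r \<and> \<bar>snd v\<bar> \<le> r"
  by (auto simp: square_def mem_Times_iff)

lemma finite_subset_square:
  assumes "finite D" obtains r where "D \<subseteq> square r" "r \<ge> 0"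
proof -
  define r where "r = (\<Sum>d\<in>D. \<bar>fst d\<bar> + \<bar>snd d\<bar>)"
  have "\<bar>fst d\<bar> + \<bar>snd d\<bar> \<le> r" if "d \<in> D" for d
    unfolding r_def by (rule member_le_sum) (use assms that in auto)
  then have "D \<subseteq> square r"
    by (force simp: in_square)
  moreover have "r \<ge> 0"
    by (auto simp: r_def intro!: sum_nonneg)
  ultimately show ?thesis using that by blast
qed

lemma square_mono: "v \<in> square m \<Longrightarrow> m \<le> n \<Longrightarrow> v \<in> square n"
  by (auto simp: in_square)

lemma square_add: "u \<in> square m \<Longrightarrow> v \<in> square n \<Longrightarrow> m + n \<le> k \<Longrightarrow> u + v \<in> square k"
  by (auto simp: in_square)

lemma shift_shift: "shift u (shift v c) = shift (v + u) c"
  by (simp add: shift_def add.assoc)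

lemma shift_0 [simp]: "shift 0 c = c"
  by (simp add: shift_def)

lemma shift_apply: "shift u c v = c (u + v)"
  by (simp add: shift_def)

lemma shift_invariantD: "shift_invariant A \<Longrightarrow> c \<in> A \<Longrightarrow> shift u c \<in> A"
  by (simp add: shift_invariant_def)

lemma shift_invariant_configurations: "shift_invariant (configurations \<Sigma>)"
  by (auto simp: shift_invariant_def configurations_def shift_def)

lemma shift_multiple:
  assumes "shift u c = c"
  shows "shift (k * fst u, k * snd u) c = c"
proof (induction k rule: int_induct[of _ 0])
  case base
  show ?case by (simp add: zero_prod_def[symmetric])
next
  case (step1 i)
  have "shift ((i + 1) * fst u, (i + 1) * snd u) c = shift u (shift (i * fst u, i * snd u) c)"
    unfolding shift_shift by (rule arg_cong2[of _ _ _ _ shift]) (auto simp: prod_eq_iff algebra_simps)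
  with step1 assms show ?case by simp
next
  case (step2 i)
  have "shift u (shift ((i - 1) * fst u, (i - 1) * snd u) c) = shift (i * fst u, i * snd u) c"
    unfolding shift_shift by (rule arg_cong2[of _ _ _ _ shift]) (auto simp: prod_eq_iff algebra_simps)
  also have "\<dots> = c" by (rule step2)
  finally have "shift (- u) (shift u (shift ((i - 1) * fst u, (i - 1) * snd u) c)) = shift (- u) (shift u c)"
    by (simp add: assms)
  then show ?case by (simp add: shift_shift)
qed

text \<open>
  Periods form a subgroup of \<open>\<int>\<^sup>2\<close>.
\<close>

lemma shift_lattice:
  assumes "shift (N, 0) c = c" "shift (0, N) c = c" "N dvd fst s" "N dvd snd s"
  shows "shift s c = c"
proof -
  obtain k l where kl: "fst s = N * k" "snd s = N * l" using assms(3,4) by (auto elim!: dvdE)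
  have s: "s = (k * N, k * 0) + (l * 0, l * N)" by (simp add: prod_eq_iff kl)
  have "shift (l * 0, l * N) (shift (k * N, k * 0) c) = c"
    using shift_multiple[OF assms(1), of k] shift_multiple[OF assms(2), of l] by simp
  then show ?thesis unfolding s shift_shift .
qed

lemma compact_space_config_topology: "finite \<Sigma> \<Longrightarrow> compact_space (config_topology \<Sigma>)"
  by (simp add: config_topology_def compact_space_product_topology compact_space_discrete_topology)

lemma Hausdorff_space_config_topology: "Hausdorff_space (config_topology \<Sigma>)"
  by (simp add: config_topology_def Hausdorff_space_product_topology)

lemma openin_cylinder:
  assumes "finite D"
  shows "openin (config_topology \<Sigma>) {c \<in> configurations \<Sigma>. agree D x c}"
proof (cases "{c \<in> configurations \<Sigma>. agree D x c} = {}")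
  case False
  have "{c \<in> configurations \<Sigma>. agree D x c} =
        (\<Pi>\<^sub>E v\<in>UNIV. if v \<in> D then {x v} \<inter> \<Sigma> else \<Sigma>)"
    by (auto simp: configurations_def agree_def PiE_iff split: if_splits; metis rangeI subsetD)
  moreover have "openin (config_topology \<Sigma>) (\<Pi>\<^sub>E v\<in>UNIV. if v \<in> D then {x v} \<inter> \<Sigma> else \<Sigma>)"
    unfolding config_topology_def
    by (rule product_topology_basis) (use assms in \<open>auto intro: finite_subset[of _ D]\<close>)
  ultimately show ?thesis by simp
qed (metis openin_empty)

text \<open>
  Cylinders form a basis of the product topology, so a property that depends on finitely many cells
  only is clopen.
\<close>

lemma openin_finitely_determined:
  assumes "finite D" "\<And>c c'. agree D c c' \<Longrightarrow> P c \<Longrightarrow> P c'"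
  shows "openin (config_topology \<Sigma>) {c \<in> configurations \<Sigma>. P c}"
proof (subst openin_subopen, intro ballI)
  fix x assume "x \<in> {c \<in> configurations \<Sigma>. P c}"
  then have "x \<in> {c \<in> configurations \<Sigma>. agree D x c}"
    "{c \<in> configurations \<Sigma>. agree D x c} \<subseteq> {c \<in> configurations \<Sigma>. P c}"
    using assms(2) by (auto simp: agree_def)
  then show "\<exists>T. openin (config_topology \<Sigma>) T \<and> x \<in> T \<and> T \<subseteq> {c \<in> configurations \<Sigma>. P c}"
    using openin_cylinder[OF assms(1)] by blast
qed

lemma closedin_finitely_determined:
  assumes "finite D" "\<And>c c'. agree D c c' \<Longrightarrow> P c \<Longrightarrow> P c'"
  shows "closedin (config_topology \<Sigma>) {c \<in> configurations \<Sigma>. P c}"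
proof -
  have "openin (config_topology \<Sigma>) {c \<in> configurations \<Sigma>. \<not> P c}"
    by (rule openin_finitely_determined[OF assms(1)]) (use assms(2) in \<open>metis agree_def\<close>)
  moreover have "configurations \<Sigma> - {c \<in> configurations \<Sigma>. P c} = {c \<in> configurations \<Sigma>. \<not> P c}"
    by auto
  ultimately show ?thesis
    by (simp add: closedin_def topspace_config_topology)
qed

lemma openin_config_contains_cylinder:
  assumes "openin (config_topology \<Sigma>) U" "x \<in> U"
  obtains D where "finite D" "{c \<in> configurations \<Sigma>. agree D x c} \<subseteq> U"
proof -
  obtain B where B: "finite {i \<in> UNIV. B i \<noteq> topspace (discrete_topology \<Sigma>)}"
      "\<forall>i\<in>UNIV. openin (discrete_topology \<Sigma>) (B i)" "x \<in> Pi\<^sub>E UNIV B" "Pi\<^sub>E UNIV B \<subseteq> U"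
    using assms unfolding config_topology_def openin_product_topology_alt by meson
  show ?thesis
  proof (rule that)
    show "finite {i. B i \<noteq> \<Sigma>}" using B(1) by simp
    show "{c \<in> configurations \<Sigma>. agree {i. B i \<noteq> \<Sigma>} x c} \<subseteq> U"
    proof safe
      fix c assume c: "c \<in> configurations \<Sigma>" "agree {i. B i \<noteq> \<Sigma>} x c"
      have "c i \<in> B i" for i
      proof (cases "B i = \<Sigma>")
        case True
        then show ?thesis using c(1) by (auto simp: configurations_def)
      next
        case False
        then have "c i = x i" using c(2) by (simp add: agree_def)
        then show ?thesis using B(3) by (auto simp: PiE_iff)
      qed
      then show "c \<in> U" using B(4) by (auto simp: PiE_iff)
    qed
  qed
qed

text \<open>
  With cylinders as neighbourhoods, accumulation becomes a statement about finite sets of cells; this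
  is the form in which derivatives are computed below.
\<close>

lemma top_derivative_config:
  assumes "A \<subseteq> configurations \<Sigma>"
  shows "top_derivative (config_topology \<Sigma>) A =
         {x \<in> A. \<forall>D. finite D \<longrightarrow> (\<exists>y\<in>A. y \<noteq> x \<and> agree D x y)}"
proof (intro equalityI subsetI)
  fix x assume "x \<in> top_derivative (config_topology \<Sigma>) A"
  then have x: "x \<in> A"
    "\<And>U. x \<in> U \<Longrightarrow> openin (config_topology \<Sigma>) U \<Longrightarrow> \<exists>y\<noteq>x. y \<in> A \<and> y \<in> U"
    by (auto simp: top_derivative_def derived_set_of_def)
  have "\<exists>y\<in>A. y \<noteq> x \<and> agree D x y" if "finite D" for D
    using x(2)[OF _ openin_cylinder[OF that, of \<Sigma> x]] assms x(1) by (auto simp: agree_def)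
  with x(1) show "x \<in> {x \<in> A. \<forall>D. finite D \<longrightarrow> (\<exists>y\<in>A. y \<noteq> x \<and> agree D x y)}"
    by blast
next
  fix x assume "x \<in> {x \<in> A. \<forall>D. finite D \<longrightarrow> (\<exists>y\<in>A. y \<noteq> x \<and> agree D x y)}"
  then have x: "x \<in> A" "\<And>D. finite D \<Longrightarrow> \<exists>y\<in>A. y \<noteq> x \<and> agree D x y" by auto
  have "\<exists>y\<noteq>x. y \<in> A \<and> y \<in> U" if U: "x \<in> U" "openin (config_topology \<Sigma>) U" for U
  proof -
    obtain D where "finite D" "{c \<in> configurations \<Sigma>. agree D x c} \<subseteq> U"
      using openin_config_contains_cylinder[OF U(2,1)] .
    then show ?thesis using x(2)[of D] assms by blast
  qed
  then show "x \<in> top_derivative (config_topology \<Sigma>) A"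
    using x(1) assms by (auto simp: top_derivative_def derived_set_of_def topspace_config_topology)
qed

lemma top_derivative_subset: "top_derivative T A \<subseteq> A"
  by (simp add: top_derivative_def)

lemma top_derivative_mono: "A \<subseteq> B \<Longrightarrow> top_derivative T A \<subseteq> top_derivative T B"
  by (auto simp: top_derivative_def derived_set_of_def) blast

lemma iterated_top_derivative_mono:
  "A \<subseteq> B \<Longrightarrow> (top_derivative T ^^ n) A \<subseteq> (top_derivative T ^^ n) B"
  by (induction n) (auto dest: top_derivative_mono)

lemma iterated_top_derivative_antimono:
  "m \<le> n \<Longrightarrow> (top_derivative T ^^ n) A \<subseteq> (top_derivative T ^^ m) A"
  by (induction n rule: dec_induct) (auto dest: subsetD[OF top_derivative_subset])

lemma closedin_top_derivative:
  assumes "closedin (config_topology \<Sigma>) A"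
  shows "closedin (config_topology \<Sigma>) (top_derivative (config_topology \<Sigma>) A)"
proof -
  have "t1_space (config_topology \<Sigma>)"
    by (simp add: Hausdorff_imp_t1_space Hausdorff_space_config_topology)
  then show ?thesis
    unfolding top_derivative_def
    by (intro closedin_Int assms) (metis assms closedin_subset closedin_derived_set_of_gen)
qed

text \<open>
  An accumulation point of a finite union accumulates on one of the parts, and belongs to that part if
  it is closed.
\<close>

lemma iterated_top_derivative_Union:
  assumes "finite I" "\<And>i. i \<in> I \<Longrightarrow> closedin (config_topology \<Sigma>) (A i)"
  shows "(top_derivative (config_topology \<Sigma>) ^^ n) (\<Union>i\<in>I. A i)
    \<subseteq> (\<Union>i\<in>I. (top_derivative (config_topology \<Sigma>) ^^ n) (A i))"
proof (induction n)
  case (Suc n)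
  let ?T = "config_topology \<Sigma>" and ?A = "\<lambda>i. (top_derivative (config_topology \<Sigma>) ^^ n) (A i)"
  have cl: "closedin ?T (?A i)" if "i \<in> I" for i
    by (induction n) (use assms(2)[OF that] in \<open>auto intro: closedin_top_derivative\<close>)
  have "top_derivative ?T (\<Union>i\<in>I. ?A i) \<subseteq> (\<Union>i\<in>I. ?T derived_set_of (?A i))"
    using assms(1) by (auto simp: top_derivative_def derived_set_of_Union)
  also have "\<dots> \<subseteq> (\<Union>i\<in>I. top_derivative ?T (?A i))"
    using cl by (force simp: top_derivative_def closedin_contains_derived_set)
  finally show ?case
    using top_derivative_mono[OF Suc.IH] by fastforce
qed simp

lemma shift_invariant_top_derivative:
  assumes "shift_invariant A" "A \<subseteq> configurations \<Sigma>"
  shows "shift_invariant (top_derivative (config_topology \<Sigma>) A)"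
  unfolding shift_invariant_def top_derivative_config[OF assms(2)]
proof safe
  fix c a b and D :: "(int \<times> int) set"
  assume c: "c \<in> A" "\<forall>D. finite D \<longrightarrow> (\<exists>y\<in>A. y \<noteq> c \<and> agree D c y)" and D: "finite D"
  obtain y where y: "y \<in> A" "y \<noteq> c" "agree ((+) (a, b) ` D) c y"
    using c(2) D by blast
  have "shift (- (a, b)) (shift (a, b) y) = y" "shift (- (a, b)) (shift (a, b) c) = c"
    by (simp_all add: shift_shift zero_prod_def[symmetric])
  then have "shift (a, b) y \<noteq> shift (a, b) c"
    using y(2) by metis
  moreover have "agree D (shift (a, b) c) (shift (a, b) y)"
    using y(3) by (auto simp: agree_def shift_apply)
  ultimately show "\<exists>y\<in>A. y \<noteq> shift (a, b) c \<and> agree D (shift (a, b) c) y"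
    using assms(1) y(1) by (meson shift_invariantD)
qed (use assms shift_invariantD in blast)

text \<open>
  An infinite closed set has an accumulation point by compactness.
\<close>

lemma finite_if_no_accumulation:
  assumes "finite \<Sigma>" "closedin (config_topology \<Sigma>) B" "B \<subseteq> A"
    and "B \<inter> top_derivative (config_topology \<Sigma>) A = {}"
  shows "finite B"
proof (rule ccontr)
  assume "infinite B"
  moreover have "compactin (config_topology \<Sigma>) B"
    by (simp add: assms closedin_compact_space compact_space_config_topology)
  ultimately obtain x where x: "x \<in> B" "x \<in> config_topology \<Sigma> derived_set_of B"
    using compactin_imp_Bolzano_Weierstrass by blast
  then have "x \<in> top_derivative (config_topology \<Sigma>) A"
    using derived_set_of_mono[OF assms(3)] assms(3) by (auto simp: top_derivative_def)
  with x(1) assms(4) show False by blast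
qed

text \<open>
  The Baire category theorem in the compact Hausdorff space \<open>A\<close>: singletons are nowhere dense if
  no point is isolated, so countably many of them cannot cover \<open>A\<close>.
\<close>

lemma countable_perfect_imp_empty:
  assumes "finite \<Sigma>" "closedin (config_topology \<Sigma>) A" "countable A"
    and "top_derivative (config_topology \<Sigma>) A = A"
  shows "A = {}"
proof -
  let ?T = "subtopology (config_topology \<Sigma>) A"
  have A: "A \<subseteq> configurations \<Sigma>"
    using assms(2) closedin_subset topspace_config_topology by metis
  have top: "topspace ?T = A"
    using A by (auto simp: topspace_config_topology)
  have H: "Hausdorff_space ?T"
    by (simp add: Hausdorff_space_config_topology Hausdorff_space_subtopology)
  have "compactin (config_topology \<Sigma>) A"
    by (simp add: assms closedin_compact_space compact_space_config_topology)
  then have "compact_space ?T"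
    by (simp add: compact_space_subtopology)
  with H have "locally_compact_space ?T \<and> regular_space ?T"
    by (simp add: compact_imp_locally_compact_space compact_Hausdorff_imp_regular_space)
  moreover have "closedin ?T {x} \<and> ?T interior_of {x} = {}" if "x \<in> A" for x
  proof
    show "closedin ?T {x}"
      using H that top by (metis Hausdorff_imp_t1_space closedin_t1_singleton)
    have "\<not> openin ?T {x}"
      using assms(4) that A top_derivative_eq_not_isolated[of A "config_topology \<Sigma>"]
      by (auto simp: topspace_config_topology)
    then show "?T interior_of {x} = {}"
      by (metis interior_of_subset openin_interior_of subset_singletonD)
  qed
  ultimately have "?T interior_of \<Union>((\<lambda>x. {x}) ` A) = {}"
    using assms(3) by (intro Baire_category_alt) auto
  then show ?thesis
    using interior_of_topspace[of ?T] unfolding top by simp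
qed

section \<open>Subshifts of finite type\<close>

lemma SFT_subset: "is_SFT \<Sigma> X \<Longrightarrow> X \<subseteq> configurations \<Sigma>"
  by (auto simp: is_SFT_def)

lemma appears_in_shift: "appears_in P (shift u c) \<Longrightarrow> appears_in P c"
  unfolding appears_in_def by (metis shift_apply add.left_commute)

lemma SFT_shift_invariant: "is_SFT \<Sigma> X \<Longrightarrow> shift_invariant X"
  using appears_in_shift shift_invariant_configurations
  unfolding is_SFT_def shift_invariant_def by fastforce

text \<open>
  Configurations will be pasted together from members of \<open>X\<close>, so the local rule is put as a comparison
  of each window with some member of \<open>X\<close> rather than with a list of patterns.
\<close>

lemma SFT_local:
  assumes "is_SFT \<Sigma> X"
  shows "\<exists>r\<ge>0. \<forall>c. (\<forall>v. \<exists>x\<in>X. agree (square r) (shift v c) x) \<longrightarrow> c \<in> X"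
proof -
  obtain F where F: "finite F" "F \<subseteq> patterns \<Sigma>"
    and X: "X = {c \<in> configurations \<Sigma>. \<forall>P \<in> F. \<not> appears_in P c}"
    using assms unfolding is_SFT_def by blast
  have "finite (\<Union>P\<in>F. dom P)"
    using F by (auto simp: patterns_def)
  then obtain r where r: "(\<Union>P\<in>F. dom P) \<subseteq> square r" "r \<ge> 0"
    using finite_subset_square by blast
  show ?thesis
  proof (intro exI conjI allI impI)
    show "r \<ge> 0" by (fact r(2))
    fix c assume c: "\<forall>v. \<exists>x\<in>X. agree (square r) (shift v c) x"
    have "c v \<in> \<Sigma>" for v
    proof -
      obtain x where x: "x \<in> X" "agree (square r) (shift v c) x" using c by blast
      have "c v = x 0"
      proof -
        have "0 \<in> square r" using r(2) by (simp add: in_square)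
        then show ?thesis using x(2) by (auto simp: agree_def shift_apply dest: bspec[where x=0])
      qed
      then show ?thesis using x(1) SFT_subset[OF assms] by (auto simp: configurations_def)
    qed
    moreover have "\<not> appears_in P c" if P: "P \<in> F" for P
    proof
      assume "appears_in P c"
      then obtain v where v: "\<forall>a\<in>dom P. P a = Some (c (a + v))"
        by (auto simp: appears_in_def)
      obtain x where x: "x \<in> X" "agree (square r) (shift v c) x" using c by blast
      have "P a = Some (x (a + 0))" if "a \<in> dom P" for a
        using v x(2) r(1) P that by (force simp: agree_def shift_apply add.commute)
      then have "appears_in P x" unfolding appears_in_def by blast
      with x(1) P X show False by blast
    qed
    ultimately show "c \<in> X" by (auto simp: X configurations_def)
  qed
qed

lemma SFT_closed:
  assumes "is_SFT \<Sigma> X"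
  shows "closedin (config_topology \<Sigma>) X"
proof -
  obtain r where r: "r \<ge> 0" "\<And>c. (\<forall>v. \<exists>x\<in>X. agree (square r) (shift v c) x) \<Longrightarrow> c \<in> X"
    using SFT_local[OF assms] by blast
  have "X = (\<Inter>v. {c \<in> configurations \<Sigma>. \<exists>x\<in>X. agree (square r) (shift v c) x})"
    using SFT_subset[OF assms] r(2) shift_invariantD[OF SFT_shift_invariant[OF assms]]
    by (auto simp: agree_def)
  also have "closedin (config_topology \<Sigma>) \<dots>"
  proof (intro closedin_Inter)
    show "closedin (config_topology \<Sigma>) S"
      if "S \<in> range (\<lambda>v. {c \<in> configurations \<Sigma>. \<exists>x\<in>X. agree (square r) (shift v c) x})" for S
    proof -
      from that obtain v where S: "S = {c \<in> configurations \<Sigma>. \<exists>x\<in>X. agree (square r) (shift v c) x}"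
        by auto
      show ?thesis
        unfolding S
        by (rule closedin_finitely_determined[of "(+) v ` square r"])
          (auto simp: agree_def shift_apply)
    qed
  qed auto
  finally show ?thesis .
qed

lemma periodic_closed:
  assumes "closedin (config_topology \<Sigma>) X"
  shows "closedin (config_topology \<Sigma>) {c \<in> X. shift s c = c}"
proof -
  have "{c \<in> X. shift s c = c} = X \<inter> (\<Inter>v. {c \<in> configurations \<Sigma>. c (s + v) = c v})"
    using closedin_subset[OF assms] by (auto simp: topspace_config_topology shift_def fun_eq_iff)
  moreover have "closedin (config_topology \<Sigma>) {c \<in> configurations \<Sigma>. c (s + v) = c v}" for v
    by (rule closedin_finitely_determined[of "{v, s + v}"]) (auto simp: agree_def)
  ultimately show ?thesis
    using assms by (auto intro!: closedin_Int closedin_Inter)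
qed

section \<open>Cantor--Bendixson derivatives along a well-order\<close>

lemma cb_derivative_properties:
  fixes r :: "'o rel"
  assumes "Well_order r" "closedin (config_topology \<Sigma>) X" "shift_invariant X" "\<alpha> \<in> Field r"
  shows "closedin (config_topology \<Sigma>) (cb_derivative r (config_topology \<Sigma>) X \<alpha>) \<and>
         shift_invariant (cb_derivative r (config_topology \<Sigma>) X \<alpha>)"
proof -
  interpret wo_rel r by (rule wo_rel.intro) fact
  let ?D = "cb_derivative r (config_topology \<Sigma>) X"
  have "\<alpha> \<in> Field r \<longrightarrow> closedin (config_topology \<Sigma>) (?D \<alpha>) \<and> shift_invariant (?D \<alpha>)"
  proof (induction \<alpha> rule: well_order_inductZSL)
    case Zero
    show ?case using assms by (simp add: cb_derivative_zero)
  next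
    case (Suc i)
    have "i \<in> Field r" using Suc.hyps by (meson FieldI1 succ_in)
    with Suc have c: "closedin (config_topology \<Sigma>) (?D i)" "shift_invariant (?D i)" by auto
    moreover have "?D i \<subseteq> configurations \<Sigma>"
      using closedin_subset[OF c(1)] by (simp add: topspace_config_topology)
    ultimately show ?case
      unfolding cb_derivative_succ[OF assms(1) Suc.hyps]
      by (simp add: closedin_top_derivative shift_invariant_top_derivative)
  next
    case (Lim i)
    show ?case
    proof
      assume i: "i \<in> Field r"
      have IH: "closedin (config_topology \<Sigma>) (?D j)" "shift_invariant (?D j)" if "j \<in> underS i" for j
        using Lim.IH[OF that] that by (auto simp: underS_def Field_def)
      have "wo_rel.zero r \<in> underS i"
        using i Lim.hyps(2) by (intro underS_I) auto
      then have "closedin (config_topology \<Sigma>) (\<Inter>j\<in>underS i. ?D j)"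
        using IH by (intro closedin_Inter) auto
      moreover have "shift_invariant (\<Inter>j\<in>underS i. ?D j)"
        using IH(2) by (auto simp: shift_invariant_def)
      ultimately show "closedin (config_topology \<Sigma>) (?D i) \<and> shift_invariant (?D i)"
        unfolding cb_derivative_lim[OF assms(1) Lim.hyps] by simp
    qed
  qed
  with assms(4) show ?thesis by blast
qed

lemma cb_derivative_antimono:
  fixes r :: "'o rel"
  assumes "Well_order r" "(\<alpha>, \<beta>) \<in> r"
  shows "cb_derivative r T X \<beta> \<subseteq> cb_derivative r T X \<alpha>"
proof -
  interpret wo_rel r by (rule wo_rel.intro) fact
  have "(\<alpha>, \<beta>) \<in> r \<longrightarrow> cb_derivative r T X \<beta> \<subseteq> cb_derivative r T X \<alpha>"
  proof (induction \<beta> rule: well_order_inductZSL)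
    case Zero
    show ?case using leq_zero_imp by blast
  next
    case (Suc i)
    then show ?case
      using top_derivative_subset cb_derivative_succ[OF assms(1) Suc.hyps]
      by (metis less_succ order_refl order_trans)
  next
    case (Lim i)
    show ?case
      unfolding cb_derivative_lim[OF assms(1) Lim.hyps]
      by (cases "\<alpha> = i") (auto simp: underS_def cb_derivative_lim[OF assms(1) Lim.hyps])
  qed
  with assms(2) show ?thesis by blast
qed

text \<open>
  A limit \<open>\<mu>\<close> above \<open>\<alpha>\<close> is above \<open>\<alpha> + n\<close> for every natural number \<open>n\<close>.
\<close>

lemma cb_derivative_lim_subset_iterate:
  fixes r :: "'o rel"
  assumes "Well_order r" "wo_rel.isLim r \<mu>" "\<alpha> \<in> underS r \<mu>"
  shows "cb_derivative r T X \<mu> \<subseteq> (top_derivative T ^^ n) (cb_derivative r T X \<alpha>)"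
proof -
  interpret wo_rel r by (rule wo_rel.intro) fact
  have "\<exists>\<beta>\<in>underS \<mu>. cb_derivative r T X \<beta> \<subseteq> (top_derivative T ^^ n) (cb_derivative r T X \<alpha>)"
  proof (induction n)
    case 0
    show ?case using assms(3) by auto
  next
    case (Suc n)
    then obtain \<beta> where \<beta>: "\<beta> \<in> underS \<mu>"
      "cb_derivative r T X \<beta> \<subseteq> (top_derivative T ^^ n) (cb_derivative r T X \<alpha>)" by blast
    have above: "aboveS \<beta> \<noteq> {}" using \<beta>(1) by (auto simp: aboveS_def underS_def)
    have "succ \<beta> \<noteq> \<mu>" using assms(2) above isSucc_succ isLim_def by blast
    moreover have "(succ \<beta>, \<mu>) \<in> r" using \<beta>(1) by (intro succ_smallest) (auto simp: underS_def)
    ultimately have "succ \<beta> \<in> underS \<mu>" by (simp add: underS_def)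
    moreover have "cb_derivative r T X (succ \<beta>) \<subseteq> (top_derivative T ^^ Suc n) (cb_derivative r T X \<alpha>)"
      using \<beta>(2) by (simp add: cb_derivative_succ[OF assms(1) above] top_derivative_mono)
    ultimately show ?case by blast
  qed
  then show ?thesis
    using cb_derivative_antimono[OF assms(1)] by (fastforce simp: underS_def)
qed

lemma finite_chain_Inter_mem:
  assumes "finite \<F>" "\<F> \<noteq> {}" "\<And>A B. A \<in> \<F> \<Longrightarrow> B \<in> \<F> \<Longrightarrow> A \<subseteq> B \<or> B \<subseteq> A"
  shows "\<Inter>\<F> \<in> \<F>"
  using assms
proof (induction \<F> rule: finite_ne_induct)
  case (insert A \<F>)
  then have "\<Inter>\<F> \<in> \<F>" by blast
  then have "A \<subseteq> \<Inter>\<F> \<or> \<Inter>\<F> \<subseteq> A" using insert.prems by blast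
  then have "A \<inter> \<Inter>\<F> = A \<or> A \<inter> \<Inter>\<F> = \<Inter>\<F>" by blast
  then show ?case using \<open>\<Inter>\<F> \<in> \<F>\<close> by auto
qed simp

text \<open>
  The configurations of \<open>C i\<close> that do not look like a member of the intersection on \<open>D\<close> form a
  closed set. If none of these sets were empty, then by compactness they would have a common point.
\<close>

lemma chain_locally_like_intersection:
  assumes "finite \<Sigma>" "I \<noteq> {}" "finite D"
    and C: "\<And>i. i \<in> I \<Longrightarrow> closedin (config_topology \<Sigma>) (C i)"
    and chain: "\<And>i j. i \<in> I \<Longrightarrow> j \<in> I \<Longrightarrow> C i \<subseteq> C j \<or> C j \<subseteq> C i"
  shows "\<exists>i\<in>I. \<forall>c\<in>C i. \<exists>z\<in>(\<Inter>i\<in>I. C i). agree D c z"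
proof (rule ccontr)
  assume contra: "\<not> ?thesis"
  define B where "B = {c \<in> configurations \<Sigma>. \<not> (\<exists>z\<in>(\<Inter>i\<in>I. C i). agree D c z)}"
  have "closedin (config_topology \<Sigma>) B"
    unfolding B_def using assms(3) by (rule closedin_finitely_determined) (auto simp: agree_def)
  then have cl: "\<forall>A\<in>(\<lambda>i. C i \<inter> B) ` I. closedin (config_topology \<Sigma>) A"
    using C by auto
  have ne: "C i \<inter> B \<noteq> {}" if "i \<in> I" for i
    using contra that closedin_subset[OF C[OF that]]
    by (auto simp: B_def topspace_config_topology)
  have "\<Inter>\<F> \<noteq> {}" if \<F>: "finite \<F>" "\<F> \<subseteq> (\<lambda>i. C i \<inter> B) ` I" for \<F>
  proof (cases "\<F> = {}")
    case False
    have "A \<subseteq> A' \<or> A' \<subseteq> A" if A: "A \<in> \<F>" "A' \<in> \<F>" for A A'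
    proof -
      obtain i j where "i \<in> I" "j \<in> I" "A = C i \<inter> B" "A' = C j \<inter> B" using A \<F>(2) by blast
      with chain[of i j] show ?thesis by blast
    qed
    then have "\<Inter>\<F> \<in> \<F>" using finite_chain_Inter_mem[OF \<F>(1) False] by blast
    then obtain i where "i \<in> I" "\<Inter>\<F> = C i \<inter> B" using \<F>(2) by blast
    then show ?thesis using ne by simp
  qed simp
  with cl have "\<Inter>((\<lambda>i. C i \<inter> B) ` I) \<noteq> {}"
    by (intro compact_space_config_topology[OF assms(1), unfolded compact_space_fip, THEN spec, THEN mp])
      (intro conjI allI impI, auto)
  then obtain c where "c \<in> (\<Inter>i\<in>I. C i)" "c \<in> B" using assms(2) by auto
  then show False by (auto simp: B_def agree_def)
qed

section \<open>Walks in a directed graph with a fork\<close>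

lemma uncountable_if_inj_binary_sequences:
  assumes "inj (p :: (int \<Rightarrow> bool) \<Rightarrow> 'b)" "range p \<subseteq> A"
  shows "uncountable A"
proof
  assume "countable A"
  then have "countable (range p)" using assms(2) countable_subset by blast
  then have "countable (UNIV :: (int \<Rightarrow> bool) set)"
    using assms(1) by (simp add: countable_image_inj_eq)
  then obtain f :: "nat \<Rightarrow> int \<Rightarrow> bool" where f: "range f = UNIV"
    using uncountable_def by (metis UNIV_not_empty)
  obtain n where "f n = (\<lambda>k. \<not> f (nat k) k)"
    using f by (metis surjD)
  then have "f n (int n) = (\<not> f n (int n))" by (metis nat_int)
  then show False by simp
qed

text \<open>
  The two edges extend to two closed walks through \<open>a\<close>. Traversing both, in one order or in the other,
  gives two blocks of the same length that differ in their second vertex, and blocks can be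
  concatenated freely along any binary sequence.
\<close>

lemma uncountable_walks_if_fork:
  fixes E :: "'v \<Rightarrow> 'v \<Rightarrow> bool"
  assumes "E a b" "E a b'" "b \<noteq> b'" "E\<^sup>*\<^sup>* b a" "E\<^sup>*\<^sup>* b' a"
  shows "uncountable {p :: int \<Rightarrow> 'v. \<forall>t. E (p t) (p (t + 1))}"
proof -
  have loop: "\<exists>f m. f 0 = a \<and> f 1 = c \<and> f m = a \<and> m \<ge> 1 \<and> (\<forall>i<m. E (f i) (f (Suc i)))"
    if c: "E a c" "E\<^sup>*\<^sup>* c a" for c
  proof -
    obtain n where "(E ^^ n) c a" using c(2) by (meson rtranclp_power)
    then obtain f where f: "f 0 = c" "f n = a" "\<forall>i<n. E (f i) (f (Suc i))"
      by (auto simp: relpowp_fun_conv)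
    show ?thesis
      by (rule exI[of _ "\<lambda>i. case i of 0 \<Rightarrow> a | Suc i \<Rightarrow> f i"], rule exI[of _ "Suc n"])
        (use f c in \<open>auto split: nat.split\<close>)
  qed
  obtain f m where f: "f 0 = a" "f 1 = b" "f m = a" "m \<ge> 1" "\<And>i. i < m \<Longrightarrow> E (f i) (f (Suc i))"
    using loop[OF assms(1,4)] by blast
  obtain g n where g: "g 0 = a" "g 1 = b'" "g n = a" "n \<ge> 1" "\<And>i. i < n \<Longrightarrow> E (g i) (g (Suc i))"
    using loop[OF assms(2,5)] by blast
  define L where "L = m + n"
  have L: "L \<ge> 2" using f g by (simp add: L_def)
  \<comment> \<open>The closed walk f followed by g, or g followed by f.\<close>
  define B where "B x i = (if x then if i < m then f i else g (i - m)
                                else if i < n then g i else f (i - n))" for x i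
  have B0: "B x 0 = a" "B x L = a" for x using f g by (auto simp: B_def L_def)
  have B1: "B True 1 = b" "B False 1 = b'"
    using f g by (auto simp: B_def not_less le_Suc_eq)
  have BE: "E (B x i) (B x (Suc i))" if "i < L" for x i
  proof (cases x)
    case True
    show ?thesis
    proof (cases "Suc i = m")
      case True with \<open>x\<close> show ?thesis using f(5)[of i] f(3) g(1) by (simp add: B_def)
    next
      case False with \<open>x\<close> show ?thesis using f(5)[of i] g(5)[of "i - m"] that
        by (auto simp: B_def L_def Suc_diff_le not_less)
    qed
  next
    case x: False
    show ?thesis
    proof (cases "Suc i = n")
      case True with x show ?thesis using g(5)[of i] g(3) f(1) by (simp add: B_def)
    next
      case False with x show ?thesis using g(5)[of i] f(5)[of "i - n"] that
        by (auto simp: B_def L_def Suc_diff_le not_less)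
    qed
  qed
  define p where "p s t = B (s (t div int L)) (nat (t mod int L))" for s :: "int \<Rightarrow> bool" and t
  have "E (p s t) (p s (t + 1))" for s t
  proof -
    define i where "i = nat (t mod int L)"
    have i: "i < L" "t mod int L = int i" using L by (auto simp: i_def nat_less_iff)
    have t: "t = int L * (t div int L) + int i" using i(2) by (metis mult_div_mod_eq)
    show ?thesis
    proof (cases "Suc i = L")
      case True
      then have "t + 1 = int L * (t div int L + 1)" using t by (auto simp: algebra_simps)
      then have "p s (t + 1) = a" using B0 L by (simp add: p_def)
      moreover have "p s t = B (s (t div int L)) i" by (simp add: p_def i_def)
      ultimately show ?thesis using BE[OF i(1)] True B0 by metis
    next
      case False
      then have "(t + 1) div int L = t div int L" "(t + 1) mod int L = int i + 1"
        using i int_div_pos_eq[of "t + 1" "int L" "t div int L" "int i + 1"]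
          int_mod_pos_eq[of "t + 1" "int L" "t div int L" "int i + 1"] t by auto
      then have "p s (t + 1) = B (s (t div int L)) (Suc i)" by (simp add: p_def nat_add_distrib)
      then show ?thesis using BE[OF i(1)] by (simp add: p_def i(2))
    qed
  qed
  moreover have "inj p"
  proof (rule injI, rule ext)
    fix s s' k assume "p s = p s'"
    then have "p s (int L * k + 1) = p s' (int L * k + 1)" by simp
    moreover have "p s (int L * k + 1) = (if s k then b else b')" for s
    proof -
      have "(int L * k + 1) div int L = k" "(int L * k + 1) mod int L = 1" using L by auto
      then show ?thesis using B1 by (simp add: p_def)
    qed
    ultimately show "s k = s' k" using assms(3) by (metis (full_types))
  qed
  ultimately show ?thesis
    by (intro uncountable_if_inj_binary_sequences[of p]) auto
qed

section \<open>Finite rank of the configurations with a given period\<close>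

lemma finite_image_if_factors:
  assumes "finite (f ` A)" "\<And>x y. x \<in> A \<Longrightarrow> y \<in> A \<Longrightarrow> f x = f y \<Longrightarrow> g x = g y"
  shows "finite (g ` A)"
proof -
  have "g x = g (inv_into A f (f x))" if "x \<in> A" for x
    using that by (intro assms(2)) (auto intro: inv_into_into simp: f_inv_into_f)
  then have "g ` A \<subseteq> (\<lambda>z. g (inv_into A f z)) ` f ` A"
    by auto
  with assms(1) show ?thesis
    using finite_surj by blast
qed

lemma finite_restrictions:
  assumes "finite \<Sigma>" "finite D" "A \<subseteq> configurations \<Sigma>"
  shows "finite ((\<lambda>c. restrict c D) ` A)"
proof (rule finite_subset)
  show "(\<lambda>c. restrict c D) ` A \<subseteq> D \<rightarrow>\<^sub>E \<Sigma>"
    using assms(3) by (fastforce simp: configurations_def)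
qed (simp add: assms finite_PiE)

lemma restrict_eq_iff_agree: "restrict c D = restrict c' D \<longleftrightarrow> agree D c c'"
  by (auto simp: agree_def fun_eq_iff)

text \<open>
  A vector \<open>(a, b)\<close> is fixed, and configurations with this period are read in strips that are parallel
  to it. The vector \<open>(- b, a)\<close> leads from one strip to the next. The assumption \<open>wide\<close> says that
  a window of the local rule meets at most two consecutive strips; every nonzero period has a
  multiple that satisfies it, because the width is quadratic and the height of a window linear in \<open>(a, b)\<close>.
\<close>

locale periodic_configurations =
  fixes \<Sigma> :: "'a set" and X :: "(int \<times> int \<Rightarrow> 'a) set" and r a b :: int
  assumes fin: "finite \<Sigma>"
    and sub: "X \<subseteq> configurations \<Sigma>"
    and inv: "shift_invariant X"
    and count: "countable X"
    and loc: "\<And>c. (\<And>v. \<exists>x\<in>X. agree (square r) (shift v c) x) \<Longrightarrow> c \<in> X"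
    and r: "r \<ge> 0"
    and wide: "2 * ((\<bar>a\<bar> + \<bar>b\<bar>) * r) \<le> a * a + b * b"
    and pos: "0 < a * a + b * b"
begin

definition K where "K = a * a + b * b"
definition W where "W = {c \<in> X. shift (a, b) c = c}"
definition height :: "int \<times> int \<Rightarrow> int" where "height v = a * snd v - b * fst v"
definition along :: "int \<times> int \<Rightarrow> int" where "along v = a * fst v + b * snd v"
definition up :: "int \<Rightarrow> int \<times> int" where "up t = (- (b * t), a * t)"
text \<open>
  The values of \<open>c\<close> in the strip with index \<open>t\<close>, moved to the strip at the origin. They are blanked
  outside the strip, so that equality of slices means agreement on a strip.
\<close>

definition slice :: "(int \<times> int \<Rightarrow> 'a) \<Rightarrow> int \<Rightarrow> int \<times> int \<Rightarrow> 'a" where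
  "slice c t = (\<lambda>v. if 0 \<le> height v \<and> height v < K then c (up t + v) else undefined)"
text \<open>
  A fundamental domain for the period within one strip.
\<close>

definition D where "D = {v. 0 \<le> height v \<and> height v < K \<and> 0 \<le> along v \<and> along v < K}"

lemma K_pos: "0 < K"
  using pos by (simp add: K_def)

lemma height_add: "height (u + v) = height u + height v"
  by (simp add: height_def algebra_simps)

lemma height_diff: "height (u - v) = height u - height v"
  by (simp add: height_def algebra_simps)

lemma height_up: "height (up t) = K * t"
  by (simp add: height_def up_def K_def algebra_simps)

lemma up_0: "up 0 = 0"
  by (simp add: up_def zero_prod_def)

lemma up_add: "up (s + t) = up s + up t"
  by (simp add: up_def algebra_simps)

lemma slice_shift: "slice (shift (up s) c) t = slice c (s + t)"
  unfolding slice_def shift_def up_add add.assoc ..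

lemma W_sub: "W \<subseteq> configurations \<Sigma>"
  using sub by (auto simp: W_def)

lemma W_inv: "shift_invariant W"
  using inv unfolding W_def shift_invariant_def by (simp add: shift_shift) (metis add.commute shift_shift)

lemma W_count: "countable W"
  using count countable_subset[of W X] by (auto simp: W_def)

lemma finite_D: "finite D"
proof (rule finite_subset)
  show "D \<subseteq> square (\<bar>a\<bar> + \<bar>b\<bar>)"
  proof
    fix v assume "v \<in> D"
    then have v: "\<bar>height v\<bar> \<le> K" "\<bar>along v\<bar> \<le> K" by (auto simp: D_def)
    have "fst v * K = a * along v - b * height v" "snd v * K = b * along v + a * height v"
      by (simp_all add: K_def along_def height_def algebra_simps)
    moreover have "\<bar>a * along v\<bar> \<le> \<bar>a\<bar> * K" "\<bar>b * along v\<bar> \<le> \<bar>b\<bar> * K"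
      "\<bar>a * height v\<bar> \<le> \<bar>a\<bar> * K" "\<bar>b * height v\<bar> \<le> \<bar>b\<bar> * K"
      using v by (simp_all add: abs_mult mult_left_mono)
    ultimately have "\<bar>fst v * K\<bar> \<le> (\<bar>a\<bar> + \<bar>b\<bar>) * K" "\<bar>snd v * K\<bar> \<le> (\<bar>a\<bar> + \<bar>b\<bar>) * K"
      unfolding distrib_right by linarith+
    then show "v \<in> square (\<bar>a\<bar> + \<bar>b\<bar>)"
      using K_pos by (simp add: in_square abs_mult)
  qed
qed simp

lemma slice_eq_if_agree:
  assumes "c \<in> W" "c' \<in> W" "agree ((+) (up t) ` D) c c'"
  shows "slice c t = slice c' t"
proof
  fix v
  show "slice c t v = slice c' t v"
  proof (cases "0 \<le> height v \<and> height v < K")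
    case True
    define k where "k = - (along v div K)"
    define u where "u = v + (k * a, k * b)"
    have "along u = along v + k * K" "height u = height v"
      by (simp_all add: u_def along_def height_def K_def algebra_simps)
    moreover have "along v + k * K = along v mod K"
      by (simp add: k_def minus_div_mult_eq_mod)
    ultimately have "u \<in> D" using True K_pos by (simp add: D_def)
    then have "c (up t + u) = c' (up t + u)"
      using assms(3) by (auto simp: agree_def)
    moreover have "d (up t + v) = d (up t + u)" if "d \<in> W" for d
    proof -
      have "shift (k * a, k * b) d = d"
        using that shift_multiple[of "(a, b)" d k] by (simp add: W_def)
      then have "d (up t + v) = d ((k * a, k * b) + (up t + v))" by (metis shift_apply)
      then show ?thesis by (simp add: u_def add_ac)
    qed
    ultimately have "c (up t + v) = c' (up t + v)"
      using assms(1,2) by metis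
    then show ?thesis by (simp add: slice_def)
  qed (auto simp: slice_def)
qed

lemma finite_slices: "finite ((\<lambda>c. slice c 0) ` W)"
proof (rule finite_image_if_factors)
  show "finite ((\<lambda>c. restrict c D) ` W)"
    by (rule finite_restrictions[OF fin finite_D W_sub])
  show "slice c 0 = slice c' 0" if "c \<in> W" "c' \<in> W" "restrict c D = restrict c' D" for c c'
    using that by (intro slice_eq_if_agree)
      (auto simp: restrict_eq_iff_agree up_0)
qed

lemma slice_in_slices: "c \<in> W \<Longrightarrow> slice c t \<in> (\<lambda>c. slice c 0) ` W"
  by (rule image_eqI[of _ _ "shift (up t) c"]) (simp_all add: slice_shift shift_invariantD[OF W_inv])

lemma eq_if_slices_eq:
  assumes "\<And>t. slice c t = slice c' t"
  shows "c = c'"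
proof
  fix v
  define t where "t = height v div K"
  have "0 \<le> height (v - up t)" "height (v - up t) < K"
    using K_pos by (simp_all add: height_diff height_up t_def minus_mult_div_eq_mod)
  then have "slice d t (v - up t) = d v" for d
    by (simp add: slice_def)
  with assms show "c v = c' v" by metis
qed

text \<open>
  Slices are the vertices of a finite graph, and its edges are the pairs of slices that occur one above
  the other.
\<close>

definition E where "E A B \<longleftrightarrow> (\<exists>c\<in>W. slice c 0 = A \<and> slice c 1 = B)"

lemma E_slice: "c \<in> W \<Longrightarrow> E (slice c t) (slice c (t + 1))"
  unfolding E_def by (rule bexI[of _ "shift (up t) c"]) (auto simp: slice_shift shift_invariantD[OF W_inv])

text \<open>
  Each window lies in two consecutive strips. There the configuration read off from the walk agrees
  with a configuration of \<open>X\<close> that witnesses an edge, so the local rule is satisfied.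
\<close>

lemma walk_realised:
  assumes "\<And>t. E (A t) (A (t + 1))"
  shows "\<exists>c\<in>W. \<forall>t. slice c t = A t"
proof -
  obtain x where x: "\<And>t. x t \<in> W" "\<And>t. slice (x t) 0 = A t" "\<And>t. slice (x t) 1 = A (t + 1)"
    using assms unfolding E_def by metis
  \<comment> \<open>Stack the slices of the walk.\<close>
  define c where "c v = A (height v div K) (v - up (height v div K))" for v
  have sl: "slice c t = A t" for t
  proof
    fix v
    show "slice c t v = A t v"
    proof (cases "0 \<le> height v \<and> height v < K")
      case True
      then have "height (up t + v) div K = t"
        by (simp add: height_add height_up)
      with True show ?thesis by (simp add: slice_def c_def)
    next
      case False
      then have "slice (x t) 0 v = undefined" "slice c t v = undefined" by (auto simp: slice_def)
      then show ?thesis by (simp add: x(2))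
    qed
  qed
  have near: "c u = x t (u - up t)" if u: "K * t \<le> height u" "height u < K * t + 2 * K" for t u
  proof (cases "height u < K * t + K")
    case True
    with u have "height u div K = t"
      using int_div_pos_eq[of "height u" K t "height u - K * t"] by auto
    then have "c u = slice (x t) 0 (u - up t)" by (simp add: c_def x(2))
    also have "\<dots> = x t (u - up t)"
      using True u by (simp add: slice_def height_diff height_up up_0)
    finally show ?thesis .
  next
    case False
    have t1: "K * (t + 1) = K * t + K" by (simp add: algebra_simps)
    with False u have "height u div K = t + 1"
      using int_div_pos_eq[of "height u" K "t + 1" "height u - K * (t + 1)"] by auto
    then have "c u = slice (x t) 1 (u - up (t + 1))" by (simp add: c_def x(3))
    also have "\<dots> = x t (up 1 + (u - up (t + 1)))"
      using False u t1 by (simp add: slice_def height_diff height_up)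
    finally show ?thesis by (simp add: up_add)
  qed
  \<comment> \<open>A window spans at most 2 \<rho> \<le> K in height, so it fits into the two strips that start
    at the one containing its lowest possible cell.\<close>
  define \<rho> where "\<rho> = (\<bar>a\<bar> + \<bar>b\<bar>) * r"
  have height_square: "\<bar>height d\<bar> \<le> \<rho>" if "d \<in> square r" for d
  proof -
    have "\<bar>a * snd d\<bar> \<le> \<bar>a\<bar> * r" "\<bar>b * fst d\<bar> \<le> \<bar>b\<bar> * r"
      using that by (simp_all add: in_square abs_mult mult_left_mono)
    then show ?thesis unfolding height_def \<rho>_def distrib_right by linarith
  qed
  have "c \<in> X"
  proof (rule loc)
    fix v
    define t where "t = (height v - \<rho>) div K"
    have t: "K * t \<le> height v - \<rho>" "height v - \<rho> < K * t + K"
      using K_pos mult_div_mod_eq[of K "height v - \<rho>"] pos_mod_bound[of K "height v - \<rho>"]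
        pos_mod_sign[of K "height v - \<rho>"] unfolding t_def by linarith+
    have "2 * \<rho> \<le> K" using wide by (simp add: \<rho>_def K_def)
    have "c (v + d) = shift (v - up t) (x t) d" if "d \<in> square r" for d
    proof -
      have "c (v + d) = x t (v + d - up t)"
        using height_square[OF that] t \<open>2 * \<rho> \<le> K\<close> by (intro near) (simp_all add: height_add)
      then show ?thesis by (simp add: shift_apply algebra_simps)
    qed
    moreover have "shift (v - up t) (x t) \<in> X"
      using x(1)[of t] shift_invariantD[OF inv] by (auto simp: W_def)
    ultimately show "\<exists>x\<in>X. agree (square r) (shift v c) x"
      by (intro bexI[of _ "shift (v - up t) (x t)"]) (simp add: agree_def shift_apply)
  qed
  moreover have "shift (a, b) c = c"
  proof
    fix v
    define t where "t = height v div K"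
    have h: "height ((a, b) + v) = height v" by (simp add: height_def algebra_simps)
    have b: "K * t \<le> height v" "height v < K * t + 2 * K"
      using K_pos mult_div_mod_eq[of K "height v"] pos_mod_bound[of K "height v"]
        pos_mod_sign[of K "height v"] unfolding t_def by linarith+
    have "c ((a, b) + v) = x t ((a, b) + v - up t)" "c v = x t (v - up t)"
      using b h by (auto intro: near)
    moreover have "x t ((a, b) + (v - up t)) = x t (v - up t)"
      using x(1)[of t] by (auto simp: W_def fun_eq_iff shift_apply)
    ultimately show "shift (a, b) c v = c v" by (simp add: shift_apply add_diff_eq)
  qed
  ultimately show ?thesis using sl by (auto simp: W_def)
qed

lemma countable_walks: "countable {A :: int \<Rightarrow> _. \<forall>t. E (A t) (A (t + 1))}"
proof (rule countable_subset)
  show "{A. \<forall>t. E (A t) (A (t + 1))} \<subseteq> slice ` W"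
  proof
    fix A :: "int \<Rightarrow> int \<times> int \<Rightarrow> 'a"
    assume "A \<in> {A. \<forall>t. E (A t) (A (t + 1))}"
    then obtain c where "c \<in> W" "\<And>t. slice c t = A t" using walk_realised by blast
    then show "A \<in> slice ` W" by (intro image_eqI[of _ _ c]) auto
  qed
qed (simp add: W_count)

text \<open>
  A second successor leading back to \<open>A\<close> would be a fork, and the walks through a fork would give
  uncountably many configurations in \<open>X\<close>.
\<close>

lemma forward_deterministic:
  assumes "E A B" "E A B'" "E\<^sup>*\<^sup>* B A" "E\<^sup>*\<^sup>* B' A"
  shows "B = B'"
  using uncountable_walks_if_fork[of E A B B'] assms countable_walks by blast

lemma backward_deterministic:
  assumes "E B A" "E B' A" "E\<^sup>*\<^sup>* A B" "E\<^sup>*\<^sup>* A B'"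
  shows "B = B'"
proof (rule ccontr)
  assume "B \<noteq> B'"
  with assms have "uncountable {A :: int \<Rightarrow> _. \<forall>t. E\<inverse>\<inverse> (A t) (A (t + 1))}"
    by (intro uncountable_walks_if_fork[of "E\<inverse>\<inverse>" A B B']) (auto simp: rtranclp_conversep)
  moreover have "{A. \<forall>t. E\<inverse>\<inverse> (A t) (A (t + 1))} \<subseteq>
      (\<lambda>A t. A (- t)) ` {A :: int \<Rightarrow> _. \<forall>t. E (A t) (A (t + 1))}"
  proof
    fix A assume A: "A \<in> {A :: int \<Rightarrow> _. \<forall>t. E\<inverse>\<inverse> (A t) (A (t + 1))}"
    have "E (A (- t)) (A (- (t + 1)))" for t
      using A by (auto dest: spec[of _ "- (t + 1)"])
    then show "A \<in> (\<lambda>A t. A (- t)) ` {A :: int \<Rightarrow> _. \<forall>t. E (A t) (A (t + 1))}"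
      by (intro image_eqI[of _ _ "\<lambda>t. A (- t)"]) auto
  qed
  ultimately show False
    using countable_subset[OF _ countable_image[OF countable_walks]] by blast
qed

text \<open>
  The positions at which the walk of \<open>c\<close> leaves a strongly connected component of the graph.
\<close>

definition transient where "transient c = {t. \<not> E\<^sup>*\<^sup>* (slice c (t + 1)) (slice c t)}"

lemma slice_reaches:
  assumes "c \<in> W" "s \<le> t"
  shows "E\<^sup>*\<^sup>* (slice c s) (slice c t)"
  using assms(2) by (induction t rule: int_ge_induct) (auto intro: rtranclp.rtrancl_into_rtrancl E_slice[OF assms(1)])

text \<open>
  A walk that has left a strongly connected component does not come back.
\<close>

lemma inj_on_transient:
  assumes "c \<in> W"
  shows "inj_on (slice c) (transient c)"
proof (rule linorder_inj_onI)
  fix s t assume st: "s < t" "s \<in> transient c" "t \<in> transient c"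
  then have "E\<^sup>*\<^sup>* (slice c (s + 1)) (slice c t)"
    by (intro slice_reaches assms) auto
  with st(2) show "slice c s \<noteq> slice c t" by (auto simp: transient_def)
qed auto

lemma finite_transient: "c \<in> W \<Longrightarrow> finite (transient c)"
  by (rule inj_on_finite[OF inj_on_transient _ finite_slices]) (use slice_in_slices in auto)

lemma card_transient: "c \<in> W \<Longrightarrow> card (transient c) \<le> card ((\<lambda>c. slice c 0) ` W)"
  by (rule card_inj_on_le[OF inj_on_transient _ finite_slices]) (use slice_in_slices in auto)

text \<open>
  The window fixes all transient edges of \<open>c\<close>, and \<open>c'\<close> has no room for further ones. Beyond the
  window both walks stay within one strongly connected component on either side, where the next
  and the previous vertex are unique.
\<close>

lemma eq_if_agree_around_transient:
  assumes c: "c \<in> W" "c' \<in> W" and n: "transient c \<subseteq> {-n..n}" "n \<ge> 0"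
    and agr: "agree (\<Union>t\<in>{-n..n+1}. (+) (up t) ` D) c c'"
    and card: "card (transient c') \<le> card (transient c)"
  shows "c = c'"
proof -
  have mid: "slice c t = slice c' t" if "t \<in> {-n..n+1}" for t
    using that agr by (intro slice_eq_if_agree c) (auto simp: agree_def)
  have "transient c \<subseteq> transient c'"
  proof
    fix t assume t: "t \<in> transient c"
    then have "t \<in> {-n..n+1}" "t + 1 \<in> {-n..n+1}" using n by auto
    with t mid show "t \<in> transient c'" by (auto simp: transient_def)
  qed
  with card have tr: "transient c' = transient c"
    using card_seteq finite_transient[OF c(2)] by blast
  have "slice c t = slice c' t" for t
  proof -
    consider "t \<ge> n + 1" | "t \<le> - n" | "t \<in> {-n..n+1}" by fastforce
    then show ?thesis
    proof cases
      case 1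
      then show ?thesis
      proof (induction t rule: int_ge_induct)
        case base
        show ?case using n by (intro mid) auto
      next
        case (step t)
        then have "t \<notin> transient c" "t \<notin> transient c'" using tr n by auto
        then show ?case
          using forward_deterministic[of "slice c t"] E_slice[OF c(1), of t] E_slice[OF c(2), of t] step
          by (simp add: transient_def)
      qed
    next
      case 2
      then show ?thesis
      proof (induction t rule: int_le_induct)
        case base
        show ?case using n by (intro mid) auto
      next
        case (step t)
        then have "t - 1 \<notin> transient c" "t - 1 \<notin> transient c'" using tr n by auto
        then show ?case
          using backward_deterministic[of "slice c (t - 1)" "slice c t" "slice c' (t - 1)"]
            E_slice[OF c(1), of "t - 1"] E_slice[OF c(2), of "t - 1"] step
          by (simp add: transient_def)
      qed
    qed (rule mid)
  qed
  then show ?thesis by (rule eq_if_slices_eq)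
qed

text \<open>
  A configuration with the maximal number of transient edges is isolated, so each derivative lowers the
  maximum.
\<close>

lemma iterated_derivative_bounds_transient:
  assumes "c \<in> (top_derivative (config_topology \<Sigma>) ^^ j) W"
  shows "c \<in> W \<and> card (transient c) + j \<le> card ((\<lambda>c. slice c 0) ` W)"
  using assms
proof (induction j arbitrary: c)
  case 0
  then show ?case using card_transient by simp
next
  case (Suc j)
  let ?V = "(top_derivative (config_topology \<Sigma>) ^^ j) W"
  have V: "?V \<subseteq> configurations \<Sigma>" using Suc.IH W_sub by blast
  have c: "c \<in> ?V" "\<And>D. finite D \<Longrightarrow> \<exists>y\<in>?V. y \<noteq> c \<and> agree D c y"
    using Suc.prems by (auto simp: top_derivative_config[OF V])
  have cW: "c \<in> W" "card (transient c) + j \<le> card ((\<lambda>c. slice c 0) ` W)"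
    using Suc.IH[OF c(1)] by auto
  have "card (transient c) + j \<noteq> card ((\<lambda>c. slice c 0) ` W)"
  proof
    assume eq: "card (transient c) + j = card ((\<lambda>c. slice c 0) ` W)"
    define n where "n = (\<Sum>t\<in>transient c. \<bar>t\<bar>)"
    have "\<bar>t\<bar> \<le> n" if "t \<in> transient c" for t
      unfolding n_def using that finite_transient[OF cW(1)] by (intro member_le_sum) auto
    then have n: "transient c \<subseteq> {-n..n}" "n \<ge> 0" by (force, simp add: n_def sum_nonneg)
    have "finite (\<Union>t\<in>{-n..n+1}. (+) (up t) ` D)" using finite_D by blast
    then obtain y where y: "y \<in> ?V" "y \<noteq> c" "agree (\<Union>t\<in>{-n..n+1}. (+) (up t) ` D) c y"
      using c(2) by meson
    have "y \<in> W" "card (transient y) + j \<le> card ((\<lambda>c. slice c 0) ` W)" using Suc.IH[OF y(1)] by auto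
    then have "c = y" using eq_if_agree_around_transient[OF cW(1) _ n y(3)] eq by linarith
    with y(2) show False by simp
  qed
  with cW show ?case by simp
qed

lemma derivatives_vanish:
  "(top_derivative (config_topology \<Sigma>) ^^ Suc (card ((\<lambda>c. slice c 0) ` W))) W = {}"
  using iterated_derivative_bounds_transient[of _ "Suc (card ((\<lambda>c. slice c 0) ` W))"] by fastforce

end

lemma periodic_configurations_finite_rank:
  assumes "finite \<Sigma>" "is_SFT \<Sigma> X" "countable X" "w \<noteq> 0"
  shows "\<exists>n. (top_derivative (config_topology \<Sigma>) ^^ n) {c \<in> X. shift w c = c} = {}"
proof -
  obtain r where r: "r \<ge> 0" "\<And>c. (\<forall>v. \<exists>x\<in>X. agree (square r) (shift v c) x) \<Longrightarrow> c \<in> X"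
    using SFT_local[OF assms(2)] by blast
  \<comment> \<open>Passing to a multiple of the period makes the strips wide compared with the windows.\<close>
  define m where "m = 2 * r + 1"
  define a where "a = m * fst w"
  define b where "b = m * snd w"
  have m: "m > 0" "2 * r \<le> m" using r(1) by (auto simp: m_def)
  have ab: "a \<noteq> 0 \<or> b \<noteq> 0" using assms(4) m by (auto simp: a_def b_def prod_eq_iff)
  have sq: "\<bar>m * x\<bar> * (2 * r) \<le> (m * x) * (m * x)" for x
  proof -
    have "\<bar>m * x\<bar> * (2 * r) \<le> \<bar>m * x\<bar> * \<bar>m * x\<bar>"
    proof (cases "x = 0")
      case False
      then have "m * 1 \<le> m * \<bar>x\<bar>" using m by (intro mult_left_mono) auto
      moreover have "\<bar>m * x\<bar> = m * \<bar>x\<bar>" using m by (simp add: abs_mult)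
      ultimately have "2 * r \<le> \<bar>m * x\<bar>" using m by linarith
      then show ?thesis by (intro mult_left_mono) auto
    qed simp
    then show ?thesis by simp
  qed
  interpret periodic_configurations \<Sigma> X r a b
  proof
    show "2 * ((\<bar>a\<bar> + \<bar>b\<bar>) * r) \<le> a * a + b * b"
      using sq[of "fst w"] sq[of "snd w"] unfolding a_def b_def by (simp add: algebra_simps)
    show "0 < a * a + b * b"
      using ab by (metis add_pos_nonneg add_nonneg_pos zero_le_square mult_eq_0_iff order_less_le)
  qed (use assms r SFT_subset SFT_shift_invariant in blast)+
  have "shift (a, b) c = c" if "shift w c = c" for c :: "int \<times> int \<Rightarrow> 'a"
    using shift_multiple[OF that, of m] by (simp add: a_def b_def)
  then have "{c \<in> X. shift w c = c} \<subseteq> W"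
    by (auto simp: W_def)
  from iterated_top_derivative_mono[OF this] show ?thesis
    using derivatives_vanish by blast
qed

section \<open>Finite perturbations of doubly periodic configurations\<close>

lemma periodic_sequence_shift:
  assumes "\<And>q :: int. g q = g (q + N)"
  shows "g q = g (q + k * N)"
proof (induction k rule: int_induct[of _ 0])
  case (step1 k)
  then show ?case using assms[of "q + k * N"] by (simp add: algebra_simps)
next
  case (step2 k)
  then show ?case using assms[of "q + (k - 1) * N"] by (simp add: algebra_simps)
qed simp

text \<open>
  Outside a square, \<open>x\<close> agrees with a doubly periodic configuration \<open>f\<close>, because the complement of a
  square is connected by steps of length \<open>N\<close> along the axes. Copies of the perturbed square can be
  pasted into \<open>f\<close> at any set of distant points of the period lattice, since every window then looks
  like one of \<open>f\<close> or like one of \<open>x\<close>.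
\<close>

lemma uncountable_if_finite_perturbation:
  fixes X :: "(int \<times> int \<Rightarrow> 'a) set"
  assumes "is_SFT \<Sigma> X" "x \<in> X" "N > 0"
    and fin: "finite {v. x v \<noteq> x (v + (N, 0)) \<or> x v \<noteq> x (v + (0, N))}"
    and ne: "{v. x v \<noteq> x (v + (N, 0)) \<or> x v \<noteq> x (v + (0, N))} \<noteq> {}"
  shows "uncountable X"
proof -
  obtain M where M: "{v. x v \<noteq> x (v + (N, 0)) \<or> x v \<noteq> x (v + (0, N))} \<subseteq> square M" "M \<ge> 0"
    using finite_subset_square[OF fin] .
  have per: "x v = x (v + (N, 0))" "x v = x (v + (0, N))" if "v \<notin> square M" for v
    using M(1) that by blast+
  obtain r where r: "r \<ge> 0" "\<And>c. (\<forall>v. \<exists>x\<in>X. agree (square r) (shift v c) x) \<Longrightarrow> c \<in> X"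
    using SFT_local[OF assms(1)] by blast
  \<comment> \<open>A coordinate congruent to p modulo N that lies beyond the square; N \<ge> 1 gives (M + 1) N > M.\<close>
  define far where "far p = p mod N + (M + 1) * N" for p
  define f where "f v = x (far (fst v), far (snd v))" for v
  have far: "far p > M" "far p = p + (M + 1 - p div N) * N" for p
  proof -
    have "M + 1 \<le> (M + 1) * N" using assms(3) M(2) by simp
    moreover have "p mod N \<ge> 0" using assms(3) by simp
    ultimately show "far p > M" unfolding far_def by linarith
    show "far p = p + (M + 1 - p div N) * N"
      by (simp add: far_def algebra_simps minus_mult_div_eq_mod[symmetric])
  qed
  have column: "x (p, q) = x (p, far q)" if "\<bar>p\<bar> > M" for p q
    unfolding far(2)
    by (rule periodic_sequence_shift[of "\<lambda>q. x (p, q)"]) (use per(2)[of "(p, _)"] that in \<open>simp add: in_square\<close>)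
  have row: "x (p, q) = x (far p, q)" if "\<bar>q\<bar> > M" for p q
    unfolding far(2)
    by (rule periodic_sequence_shift[of "\<lambda>p. x (p, q)"]) (use per(1)[of "(_, q)"] that in \<open>simp add: in_square\<close>)
  have outside: "x v = f v" if "v \<notin> square M" for v
  proof (cases "\<bar>fst v\<bar> > M")
    case True
    have "x v = x (fst v, far (snd v))" using column[OF True, of "snd v"] by simp
    also have "\<dots> = f v" unfolding f_def by (rule row) (use far(1)[of "snd v"] in simp)
    finally show ?thesis .
  next
    case False
    with that have "\<bar>snd v\<bar> > M" by (auto simp: in_square)
    then have "x v = x (far (fst v), snd v)" using row[of "snd v" "fst v"] by simp
    also have "\<dots> = f v" unfolding f_def by (rule column) (use far(1)[of "fst v"] in simp)
    finally show ?thesis .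
  qed
  have f_per: "f (v + (N * k, N * l)) = f v" for v k l
    by (simp add: f_def far_def)
  obtain p0 where p0: "x p0 \<noteq> f p0"
  proof (rule ccontr)
    assume "\<not> thesis"
    then have "x = f" using that by blast
    then show False using ne f_per[of _ 1 0] f_per[of _ 0 1] by auto
  qed
  then have p0_square: "p0 \<in> square M" using outside by blast
  \<comment> \<open>The spacing of the copies: a multiple of N, so that f is L-periodic, and large enough
    that no window meets two perturbed squares.\<close>
  define L where "L = N * (2 * M + 2 * r + 1)"
  have L: "L \<ge> 2 * M + 2 * r + 1"
    using assms(3) M(2) r(1) mult_right_mono[of 1 N "2 * M + 2 * r + 1"] by (simp add: L_def)
  define cell where "cell v = ((fst v + M) div L, (snd v + M) div L)" for v
  define site where "site q = (L * fst q, L * snd q)" for q :: "int \<times> int"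
  have f_site: "f (v + site q) = f v" "f (v - site q) = f v" for v q
    using f_per[of v "(2 * M + 2 * r + 1) * fst q" "(2 * M + 2 * r + 1) * snd q"]
      f_per[of "v - site q" "(2 * M + 2 * r + 1) * fst q" "(2 * M + 2 * r + 1) * snd q"]
    by (simp_all add: site_def L_def mult.assoc)
  have cell_eq: "cell v = q" if "v - site q \<in> square M" for v q
  proof (rule prod_eqI)
    show "fst (cell v) = fst q" "snd (cell v) = snd q"
      using that L r(1) int_div_pos_eq[of "fst v + M" L "fst q" "fst v + M - L * fst q"]
        int_div_pos_eq[of "snd v + M" L "snd q" "snd v + M - L * snd q"]
      by (auto simp: cell_def site_def in_square)
  qed
  define c where "c s v = (if s (fst (cell v)) then x (v - site (cell v)) else f v)" for s v
  have c_f: "c s v = f v" if "\<And>q. s (fst q) \<Longrightarrow> v - site q \<notin> square M" for s v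
    using that[of "cell v"] outside[of "v - site (cell v)"] by (auto simp: c_def f_site)
  have close: "\<bar>L * (k - l)\<bar> < L"
    if "\<bar>p + d - L * l\<bar> \<le> M" "\<bar>p + e - L * k\<bar> \<le> M" "\<bar>d\<bar> \<le> r" "\<bar>e\<bar> \<le> r" for p d l e k
    using that L unfolding right_diff_distrib by linarith
  have "c s \<in> X" for s
  proof (intro r(2) allI)
    fix v
    show "\<exists>y\<in>X. agree (square r) (shift v (c s)) y"
    proof (cases "\<exists>d\<in>square r. \<exists>q. s (fst q) \<and> v + d - site q \<in> square M")
      case True
      then obtain d0 q where q: "d0 \<in> square r" "s (fst q)" "v + d0 - site q \<in> square M" by blast
      have "c s (v + d) = x (v + d - site q)" if d: "d \<in> square r" for d
      proof (cases "v + d - site q \<in> square M")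
        case True
        then have "cell (v + d) = q" by (rule cell_eq)
        with q(2) show ?thesis by (simp add: c_def)
      next
        case False
        have "v + d - site q' \<notin> square M" for q'
        proof
          assume q': "v + d - site q' \<in> square M"
          have "\<bar>L * (fst q - fst q')\<bar> < L" "\<bar>L * (snd q - snd q')\<bar> < L"
            using q' q(1,3) d close[of "fst v" "fst d" "fst q'" "fst d0" "fst q"]
              close[of "snd v" "snd d" "snd q'" "snd d0" "snd q"]
            by (simp_all add: site_def in_square)
          moreover have "L > 0" using L r(1) M(2) by linarith
          ultimately have "q = q'" by (auto simp: abs_mult prod_eq_iff)
          with q' False show False by simp
        qed
        then have "c s (v + d) = f (v + d)" by (intro c_f) auto
        also have "\<dots> = x (v + d - site q)" using outside[OF False] by (simp add: f_site)
        finally show ?thesis .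
      qed
      then have "agree (square r) (shift v (c s)) (shift (v - site q) x)"
        by (simp add: agree_def shift_apply algebra_simps)
      then show ?thesis
        using shift_invariantD[OF SFT_shift_invariant[OF assms(1)] assms(2)] by blast
    next
      case False
      \<comment> \<open>No perturbed square is met: the same window of f occurs in x, sufficiently far to the right.\<close>
      define T where "T = M + r + \<bar>fst v\<bar> + 1"
      have "c s (v + d) = x (v + (N * T, 0) + d)" if d: "d \<in> square r" for d
      proof -
        have "T \<le> N * T" using assms(3) r(1) M(2) by (simp add: T_def)
        moreover have "\<bar>fst d\<bar> \<le> r" using d by (simp add: in_square)
        ultimately have "M < fst v + N * T + fst d"
          using T_def by linarith
        then have "v + (N * T, 0) + d \<notin> square M"
          unfolding in_square by auto
        then have "x (v + (N * T, 0) + d) = f (v + d + (N * T, N * 0))"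
          using outside by (simp add: add_ac)
        also have "\<dots> = f (v + d)" by (rule f_per)
        also have "\<dots> = c s (v + d)" using False d by (intro c_f[symmetric]) auto
        finally show ?thesis by simp
      qed
      then have "agree (square r) (shift v (c s)) (shift (v + (N * T, 0)) x)"
        by (simp add: agree_def shift_apply)
      then show ?thesis
        using shift_invariantD[OF SFT_shift_invariant[OF assms(1)] assms(2)] by blast
    qed
  qed
  moreover have "inj c"
  proof (rule injI, rule ext)
    fix s s' k assume eq: "c s = c s'"
    define p where "p = p0 + site (k, 0)"
    have "cell p = (k, 0)" using p0_square by (intro cell_eq) (simp add: p_def)
    then have "c s p = (if s k then x p0 else f p0)" for s
      using f_site(1)[of p0 "(k, 0)"] by (simp add: c_def p_def)
    with eq p0 show "s k = s' k" by (metis (full_types))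
  qed
  ultimately show ?thesis
    by (intro uncountable_if_inj_binary_sequences[of c]) auto
qed

text \<open>
  Translation by a fixed vector permutes a finite set, so all its orbits are finite.
\<close>

lemma finite_shift_invariant_periodic:
  fixes F :: "(int \<times> int \<Rightarrow> 'a) set"
  assumes "finite F" "shift_invariant F"
  shows "\<exists>N>0. \<forall>f\<in>F. shift (N, 0) f = f \<and> shift (0, N) f = f"
proof -
  have period: "\<exists>n>0. shift (n * fst u, n * snd u) f = f" if f: "f \<in> F" for f u
  proof -
    let ?g = "\<lambda>k :: nat. shift (int k * fst u, int k * snd u) f"
    have "range ?g \<subseteq> F" using f assms(2) by (auto simp: shift_invariant_def)
    then have "\<not> inj ?g"
      using finite_imageD[of ?g UNIV] finite_subset[of "range ?g" F] assms(1) infinite_UNIV_nat by blast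
    then obtain i j where "?g i = ?g j" "i < j"
      using linorder_injI[of ?g] by blast
    then have "shift (- (int i * fst u, int i * snd u)) (?g i) = shift (- (int i * fst u, int i * snd u)) (?g j)"
      by simp
    then have "shift (int (j - i) * fst u, int (j - i) * snd u) f = f"
      using \<open>i < j\<close> by (simp add: shift_shift zero_prod_def[symmetric] of_nat_diff left_diff_distrib)
    then show ?thesis using \<open>i < j\<close> by (intro exI[of _ "int (j - i)"]) auto
  qed
  obtain m where m: "\<And>f. f \<in> F \<Longrightarrow> m f > 0 \<and> shift (m f, 0) f = f"
    using period[of _ "(1, 0)"] by simp metis
  obtain n where n: "\<And>f. f \<in> F \<Longrightarrow> n f > 0 \<and> shift (0, n f) f = f"
    using period[of _ "(0, 1)"] by simp metis
  define N where "N = (\<Prod>f\<in>F. m f * n f)"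
  have "shift (N, 0) f = f \<and> shift (0, N) f = f" if f: "f \<in> F" for f
  proof -
    have "m f * n f dvd N"
      unfolding N_def using f assms(1) by (intro dvd_prodI) auto
    then obtain k where "N = k * (m f * n f)" by (metis dvdE mult.commute)
    then have "N = (k * n f) * m f" "N = (k * m f) * n f" by simp_all
    then show ?thesis
      using shift_multiple[of "(m f, 0)" f "k * n f"] shift_multiple[of "(0, n f)" f "k * m f"] m[OF f] n[OF f]
      by (metis fst_conv mult_zero_right snd_conv)
  qed
  moreover have "N > 0" unfolding N_def using m n by (intro prod_pos) auto
  ultimately show ?thesis by blast
qed

section \<open>Local periodicity\<close>

text \<open>
  Replacing each period by a multiple whose first nonzero coordinate is a common value \<open>M\<close> makes
  parallel periods equal.
\<close>

lemma normalised_stabiliser_vectors: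
  fixes K :: "(int \<times> int \<Rightarrow> 'a) set"
  assumes "finite K" "N > 0" "\<forall>x\<in>K. \<exists>w. w \<noteq> 0 \<and> shift w x = x"
  shows "\<exists>S. finite S \<and> S \<noteq> {} \<and> (\<forall>s\<in>S. s \<noteq> 0 \<and> N dvd fst s \<and> N dvd snd s) \<and>
     (\<forall>s\<in>S. \<forall>s'\<in>S. fst s * snd s' = snd s * fst s' \<longrightarrow> s = s') \<and>
     (\<forall>x\<in>K. \<exists>s\<in>S. shift s x = x)"
proof -
  obtain w where w: "\<And>x. x \<in> K \<Longrightarrow> w x \<noteq> 0 \<and> shift (w x) x = x"
    using assms(3) by metis
  \<comment> \<open>The leading coordinate.\<close>
  define p where "p x = (if fst (w x) \<noteq> 0 then fst (w x) else snd (w x))" for x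
  have p: "p x \<noteq> 0" if "x \<in> K" for x
    using w[OF that] by (auto simp: p_def prod_eq_iff)
  define P where "P = (\<Prod>x\<in>K. p x)"
  define M where "M = N * P"
  have P: "p x dvd P" if "x \<in> K" for x
    unfolding P_def using assms(1) that by (intro dvd_prodI) auto
  have "P \<noteq> 0" unfolding P_def using assms(1) p by (simp add: prod_zero_iff)
  then have M: "M \<noteq> 0" using assms(2) by (simp add: M_def)
  define v where "v x = (N * (P div p x) * fst (w x), N * (P div p x) * snd (w x))" for x
  have v: "fst (v x) = M \<or> fst (v x) = 0 \<and> snd (v x) = M" "N dvd fst (v x)" "N dvd snd (v x)"
    "shift (v x) x = x" if "x \<in> K" for x
  proof -
    show "fst (v x) = M \<or> fst (v x) = 0 \<and> snd (v x) = M"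
      using P[OF that] by (cases "fst (w x) = 0") (auto simp: v_def p_def M_def)
    show "shift (v x) x = x" unfolding v_def using w[OF that] by (intro shift_multiple) auto
  qed (simp_all add: v_def)
  \<comment> \<open>The vector (M, 0) keeps S nonempty when K is empty.\<close>
  define S where "S = insert (M, 0) (v ` K)"
  have S: "fst s = M \<or> fst s = 0 \<and> snd s = M" "N dvd fst s" "N dvd snd s" if "s \<in> S" for s
    using that v by (auto simp: S_def M_def)
  have "s = s'" if "s \<in> S" "s' \<in> S" "fst s * snd s' = snd s * fst s'" for s s'
    using S(1)[OF that(1)] S(1)[OF that(2)] that(3) M by (auto simp: prod_eq_iff)
  moreover have "s \<noteq> 0" if "s \<in> S" for s
    using S(1)[OF that] M by auto
  moreover have "finite S" "S \<noteq> {}" "\<forall>x\<in>K. \<exists>s\<in>S. shift s x = x"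
    using assms(1) v(4) by (auto simp: S_def)
  ultimately show ?thesis using S(2,3) by (intro exI[of _ S]) auto
qed

lemma finite_distinguishing_square:
  fixes K :: "(int \<times> int \<Rightarrow> 'a) set"
  assumes "finite K"
  shows "\<exists>\<rho>\<ge>0. \<forall>x\<in>K. \<forall>y\<in>K. agree (square \<rho>) x y \<longrightarrow> x = y"
proof -
  have "\<exists>v. x \<noteq> y \<longrightarrow> x v \<noteq> y v" for x y :: "int \<times> int \<Rightarrow> 'a" by auto
  then obtain g where g: "\<And>x y :: int \<times> int \<Rightarrow> 'a. x \<noteq> y \<longrightarrow> x (g x y) \<noteq> y (g x y)" by metis
  have "finite ((\<lambda>(x, y). g x y) ` (K \<times> K))" using assms by blast
  then obtain \<rho> where \<rho>: "(\<lambda>(x, y). g x y) ` (K \<times> K) \<subseteq> square \<rho>" "\<rho> \<ge> 0"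
    using finite_subset_square by blast
  have "x = y" if "x \<in> K" "y \<in> K" "agree (square \<rho>) x y" for x y
  proof -
    have "g x y \<in> square \<rho>" using \<rho>(1) that by auto
    with that(3) g show ?thesis by (auto simp: agree_def)
  qed
  with \<rho>(2) show ?thesis by blast
qed

text \<open>
  Cramer's rule with division with remainder: modulo the lattice spanned by two independent vectors,
  every vector is equivalent to one in their parallelogram.
\<close>

lemma lattice_reduction:
  fixes w w' \<delta> :: "int \<times> int"
  assumes "w \<in> square \<sigma>" "w' \<in> square \<sigma>" "fst w * snd w' \<noteq> snd w * fst w'"
  shows "\<exists>k l. \<delta> - (k * fst w, k * snd w) - (l * fst w', l * snd w') \<in> square (2 * \<sigma>)"
proof -
  define \<Delta> where "\<Delta> = fst w * snd w' - snd w * fst w'"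
  define \<alpha> where "\<alpha> = fst \<delta> * snd w' - snd \<delta> * fst w'"
  define \<beta> where "\<beta> = fst w * snd \<delta> - snd w * fst \<delta>"
  have \<Delta>: "\<Delta> \<noteq> 0" using assms(3) by (simp add: \<Delta>_def)
  have bound: "\<bar>d - (\<alpha> div \<Delta>) * p - (\<beta> div \<Delta>) * p'\<bar> \<le> 2 * \<sigma>"
    if eq: "\<Delta> * d = \<alpha> * p + \<beta> * p'" and le: "\<bar>p\<bar> \<le> \<sigma>" "\<bar>p'\<bar> \<le> \<sigma>" for d p p'
  proof -
    have \<alpha>: "\<alpha> = \<Delta> * (\<alpha> div \<Delta>) + \<alpha> mod \<Delta>" and \<beta>: "\<beta> = \<Delta> * (\<beta> div \<Delta>) + \<beta> mod \<Delta>" by simp_all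
    have "\<Delta> * (d - (\<alpha> div \<Delta>) * p - (\<beta> div \<Delta>) * p') =
        \<alpha> * p + \<beta> * p' - \<Delta> * (\<alpha> div \<Delta>) * p - \<Delta> * (\<beta> div \<Delta>) * p'"
      by (simp add: right_diff_distrib eq mult.assoc)
    also have "\<dots> = (\<alpha> mod \<Delta>) * p + (\<beta> mod \<Delta>) * p'"
      by (simp add: minus_mult_div_eq_mod[symmetric] algebra_simps)
    finally have "\<bar>\<Delta>\<bar> * \<bar>d - (\<alpha> div \<Delta>) * p - (\<beta> div \<Delta>) * p'\<bar> =
        \<bar>(\<alpha> mod \<Delta>) * p + (\<beta> mod \<Delta>) * p'\<bar>"
      by (metis abs_mult)
    also have "\<dots> \<le> \<bar>\<alpha> mod \<Delta>\<bar> * \<bar>p\<bar> + \<bar>\<beta> mod \<Delta>\<bar> * \<bar>p'\<bar>"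
      by (metis abs_mult abs_triangle_ineq)
    also have "\<dots> \<le> \<bar>\<Delta>\<bar> * \<sigma> + \<bar>\<Delta>\<bar> * \<sigma>"
      using le abs_mod_less[OF \<Delta>, of \<alpha>] abs_mod_less[OF \<Delta>, of \<beta>]
      by (intro add_mono mult_mono) auto
    also have "\<dots> = \<bar>\<Delta>\<bar> * (2 * \<sigma>)" by simp
    finally show ?thesis using \<Delta> by simp
  qed
  have "\<Delta> * fst \<delta> = \<alpha> * fst w + \<beta> * fst w'" "\<Delta> * snd \<delta> = \<alpha> * snd w + \<beta> * snd w'"
    by (simp_all add: \<Delta>_def \<alpha>_def \<beta>_def algebra_simps)
  then have "\<delta> - ((\<alpha> div \<Delta>) * fst w, (\<alpha> div \<Delta>) * snd w) -
      ((\<beta> div \<Delta>) * fst w', (\<beta> div \<Delta>) * snd w') \<in> square (2 * \<sigma>)"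
    using assms(1,2) by (auto simp: in_square intro!: bound)
  then show ?thesis by blast
qed

text \<open>
  A cell \<open>v\<close> is bad for \<open>c\<close> if \<open>c\<close> changes between \<open>v\<close> and \<open>v + s\<close> for some \<open>s \<in> S\<close>. Around a bad
  cell, \<open>c\<close> looks like one of the finitely many members of \<open>Z\<close> with a bad origin, called its
  type, and this type has a period in \<open>S\<close>. Moving by this period leads to a cell of the same type, so
  bad cells come in lines. Two lines in different directions would come so close that one type
  would be visible in the window of the other; then the types would be translates of each other
  and have the same period. So one \<open>w \<in> S\<close> is the period of all types in \<open>c\<close>. It is a period of \<open>c\<close>:
  at bad cells because of the type, and at all other cells by the definition of bad.
\<close>

lemma local_periodicity:
  fixes Z :: "(int \<times> int \<Rightarrow> 'a) set" and S :: "(int \<times> int) set"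
  assumes Z: "shift_invariant Z" and S: "finite S" "S \<noteq> {}"
    and K: "finite {z \<in> Z. \<exists>s\<in>S. z 0 \<noteq> z s}"
    and par: "\<And>s s'. s \<in> S \<Longrightarrow> s' \<in> S \<Longrightarrow> fst s * snd s' = snd s * fst s' \<Longrightarrow> s = s'"
    and stab: "\<And>z. z \<in> Z \<Longrightarrow> \<exists>s\<in>S. z 0 \<noteq> z s \<Longrightarrow> \<exists>s\<in>S. shift s z = z"
  shows "\<exists>R. \<forall>c. (\<forall>v. \<exists>z\<in>Z. agree (square R) (shift v c) z) \<longrightarrow> (\<exists>s\<in>S. shift s c = c)"
proof -
  define K where "K = {z \<in> Z. \<exists>s\<in>S. z 0 \<noteq> z s}"
  \<comment> \<open>The choice depends only on the set of periods of z, hence is the same for all translates of z.\<close>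
  define dir where "dir z = (SOME s. s \<in> S \<and> shift s z = z)" for z :: "int \<times> int \<Rightarrow> 'a"
  have dir: "dir x \<in> S" "shift (dir x) x = x" if "x \<in> K" for x
  proof -
    have "\<exists>s. s \<in> S \<and> shift s x = x" using stab that by (auto simp: K_def)
    from someI_ex[OF this] show "dir x \<in> S" "shift (dir x) x = x" by (auto simp: dir_def)
  qed
  have stab_shift: "shift s (shift u x) = shift u x \<longleftrightarrow> shift s x = x" for s u and x :: "int \<times> int \<Rightarrow> 'a"
  proof
    assume "shift s (shift u x) = shift u x"
    then have "shift (- u) (shift s (shift u x)) = shift (- u) (shift u x)" by simp
    then show "shift s x = x" by (simp add: shift_shift)
  next
    assume "shift s x = x"
    then have "shift u (shift s x) = shift u x" by simp
    then show "shift s (shift u x) = shift u x" by (simp add: shift_shift add.commute)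
  qed
  have dir_shift: "dir (shift u x) = dir x" for u x
    by (simp add: dir_def stab_shift)
  obtain \<sigma> where \<sigma>: "S \<subseteq> square \<sigma>" "\<sigma> \<ge> 0" using finite_subset_square[OF S(1)] .
  obtain \<rho> where \<rho>: "\<rho> \<ge> 0" "\<And>x y. x \<in> K \<Longrightarrow> y \<in> K \<Longrightarrow> agree (square \<rho>) x y \<Longrightarrow> x = y"
    using finite_distinguishing_square[OF K] unfolding K_def[symmetric] by blast
  \<comment> \<open>A type has to be recognised, on a square of radius \<rho>, after moving by up to 2 \<sigma> to a nearby
    line; and a bad cell at that distance is recognised from a further step of size at most \<sigma>.\<close>
  define R where "R = \<rho> + 3 * \<sigma>"
  have S_R: "0 \<in> square R" "\<And>s. s \<in> S \<Longrightarrow> s \<in> square R"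
    using \<sigma> \<rho>(1) square_mono[of _ \<sigma> R] by (auto simp: R_def in_square)
  have "\<exists>s\<in>S. shift s c = c" if c: "\<And>v. \<exists>z\<in>Z. agree (square R) (shift v c) z" for c
  proof -
    define bad where "bad v \<longleftrightarrow> (\<exists>s\<in>S. c v \<noteq> c (v + s))" for v
    define type where "type v x \<longleftrightarrow> x \<in> K \<and> (\<forall>d\<in>square R. c (v + d) = x d)" for v x
    have type_ex: "\<exists>x. type v x" if v: "bad v" for v
    proof -
      obtain z where z: "z \<in> Z" "\<forall>d\<in>square R. c (v + d) = z d"
        using c[of v] by (auto simp: agree_def shift_apply)
      obtain s where s: "s \<in> S" "c v \<noteq> c (v + s)" using v by (auto simp: bad_def)
      have "c v = z 0" "c (v + s) = z s" using z(2) S_R s(1) by (metis add_0_right, blast)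
      with z s show ?thesis by (auto simp: type_def K_def)
    qed
    have type_unique: "x = y" if "type v x" "type v y" for v x y
    proof (rule \<rho>(2))
      show "agree (square \<rho>) x y"
        using that square_mono[of _ \<rho> R] \<sigma>(2) by (auto simp: type_def agree_def R_def)
    qed (use that in \<open>auto simp: type_def\<close>)
    have type_move: "type (v + u) (shift u x)"
      if vx: "type v x" and u: "u \<in> square (2 * \<sigma>)" and bad: "bad (v + u)" for v u x
    proof -
      have x: "x \<in> K" "\<And>d. d \<in> square R \<Longrightarrow> c (v + d) = x d"
        using vx by (auto simp: type_def)
      obtain s where s: "s \<in> S" "c (v + u) \<noteq> c (v + u + s)"
        using bad by (auto simp: bad_def)
      have "u \<in> square R" "u + s \<in> square R"
        using u s(1) \<sigma> \<rho>(1) square_mono[of u "2 * \<sigma>" R] square_add[of u "2 * \<sigma>" s \<sigma> R]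
        by (auto simp: R_def)
      then have "x u \<noteq> x (u + s)" using s(2) x(2) by (metis add.assoc)
      then have ux: "shift u x \<in> K"
        using x(1) s(1) shift_invariantD[OF Z] by (auto simp: K_def shift_apply)
      obtain y where y: "type (v + u) y" using type_ex[OF bad] by blast
      have "y = shift u x"
      proof (rule \<rho>(2))
        show "agree (square \<rho>) y (shift u x)"
          unfolding agree_def
        proof
          fix d assume d: "d \<in> square \<rho>"
          have "d \<in> square R" "u + d \<in> square R"
            using d u \<sigma> \<rho>(1) square_mono[of d \<rho> R] square_add[of u "2 * \<sigma>" d \<rho> R]
            by (auto simp: R_def)
          then show "y d = shift u x d"
            using y x(2)[of "u + d"] by (auto simp: type_def shift_apply add.assoc)
        qed
      qed (use y ux in \<open>auto simp: type_def\<close>)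
      with y show ?thesis by simp
    qed
    have step: "type (v + u) x" if x: "type v x" "u \<in> square \<sigma>" "shift u x = x" for v u x
    proof -
      have K: "x \<in> K" "\<And>d. d \<in> square R \<Longrightarrow> c (v + d) = x d"
        using x(1) by (auto simp: type_def)
      then obtain s where s: "s \<in> S" "x 0 \<noteq> x s" by (auto simp: K_def)
      have "x u = x 0" "x (u + s) = x s" using x(3) by (metis add_0_right shift_apply)+
      moreover have "u \<in> square R" "u + s \<in> square R"
        using x(2) s(1) \<sigma> \<rho>(1) square_mono[of u \<sigma> R] square_add[of u \<sigma> s \<sigma> R]
        by (auto simp: R_def)
      ultimately have "c (v + u) \<noteq> c (v + u + s)" using s K(2) by (metis add.assoc)
      then have "bad (v + u)" using s(1) by (auto simp: bad_def)
      then show ?thesis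
        using type_move[OF x(1) _ _] x(2,3) square_mono[of u \<sigma> "2 * \<sigma>"] \<sigma>(2) by fastforce
    qed
    have line: "type (v + (k * fst (dir x), k * snd (dir x))) x" if x: "type v x" for v x k
    proof -
      have "x \<in> K" using x by (simp add: type_def)
      then have w: "dir x \<in> square \<sigma>" "shift (dir x) x = x" using dir \<sigma>(1) by auto
      have w': "- dir x \<in> square \<sigma>" "shift (- dir x) x = x"
        using w shift_multiple[of "dir x" x "-1"] by (auto simp: in_square uminus_prod_def)
      show ?thesis
      proof (induction k rule: int_induct[of _ 0])
        case base
        then show ?case using x by (simp add: zero_prod_def[symmetric])
      next
        case (step1 k)
        have "v + (k * fst (dir x), k * snd (dir x)) + dir x =
            v + ((k + 1) * fst (dir x), (k + 1) * snd (dir x))"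
          by (simp add: prod_eq_iff algebra_simps)
        with step[OF step1(2) w] show ?case by (rule back_subst[of "\<lambda>v. type v x"])
      next
        case (step2 k)
        have "v + (k * fst (dir x), k * snd (dir x)) + - dir x =
            v + ((k - 1) * fst (dir x), (k - 1) * snd (dir x))"
          by (simp add: prod_eq_iff algebra_simps)
        with step[OF step2(2) w'] show ?case by (rule back_subst[of "\<lambda>v. type v x"])
      qed
    qed
    have same_dir: "dir x = dir x'" if x: "type v x" "type v' x'" for v v' x x'
    proof (rule ccontr)
      assume ne: "dir x \<noteq> dir x'"
      have K: "x \<in> K" "x' \<in> K" using x by (auto simp: type_def)
      with ne have "fst (dir x) * snd (dir x') \<noteq> snd (dir x) * fst (dir x')"
        using par dir(1) by blast
      then obtain k l where kl: "v' - v - (k * fst (dir x), k * snd (dir x))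
          - (l * fst (dir x'), l * snd (dir x')) \<in> square (2 * \<sigma>)"
        using lattice_reduction[of "dir x" \<sigma> "dir x'"] dir(1) K \<sigma>(1) by blast
      define u where "u = v' - v - (k * fst (dir x), k * snd (dir x)) - (l * fst (dir x'), l * snd (dir x'))"
      have 1: "type (v + (k * fst (dir x), k * snd (dir x))) x" by (rule line[OF x(1)])
      have "v' + (- l * fst (dir x'), - l * snd (dir x')) = v + (k * fst (dir x), k * snd (dir x)) + u"
        by (simp add: u_def prod_eq_iff)
      with line[OF x(2), of "- l"] have 2: "type (v + (k * fst (dir x), k * snd (dir x)) + u) x'"
        by (rule back_subst[of "\<lambda>v. type v x'"])
      have "bad (v + (k * fst (dir x), k * snd (dir x)) + u)"
        using 2 S_R by (auto simp: type_def K_def bad_def) (metis add_0_right)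
      then have "type (v + (k * fst (dir x), k * snd (dir x)) + u) (shift u x)"
        using type_move[OF 1] kl unfolding u_def by blast
      then have "x' = shift u x" using 2 type_unique by blast
      with ne dir_shift show False by metis
    qed
    show ?thesis
    proof (cases "\<exists>v. bad v")
      case False
      obtain s where s: "s \<in> S" using S(2) by blast
      have "c v = c (v + s)" for v using False s unfolding bad_def by blast
      then have "shift s c = c" by (intro ext) (metis add.commute shift_apply)
      with s show ?thesis by blast
    next
      case True
      then obtain v0 x0 where x0: "type v0 x0" using type_ex by blast
      define w where "w = dir x0"
      have w: "w \<in> S" using dir(1) x0 by (auto simp: type_def w_def)
      have "c (v + w) = c v" for v
      proof (cases "bad v")
        case True
        then obtain x where x: "type v x" using type_ex by blast
        then have "dir x = w" using same_dir x0 w_def by blast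
        then have "x w = x 0" using dir(2)[of x] x by (metis add_0_right shift_apply type_def)
        moreover have "c (v + w) = x w" "c (v + 0) = x 0"
          using x w S_R by (auto simp: type_def simp del: add_0_right)
        ultimately show ?thesis by simp
      next
        case False
        with w show ?thesis by (auto simp: bad_def)
      qed
      then have "shift w c = c" by (simp add: shift_def fun_eq_iff add.commute)
      with w show ?thesis by blast
    qed
  qed
  then show ?thesis by blast
qed

text \<open>
  These configurations form a closed set that avoids the derivative.
\<close>

lemma finite_defects:
  assumes "finite \<Sigma>" "closedin (config_topology \<Sigma>) Z" "finite S"
    and "\<And>z s. z \<in> top_derivative (config_topology \<Sigma>) Z \<Longrightarrow> s \<in> S \<Longrightarrow> z 0 = z s"
  shows "finite {z \<in> Z. \<exists>s\<in>S. z 0 \<noteq> z s}"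
proof (rule finite_if_no_accumulation[OF assms(1)])
  have "{z \<in> Z. \<exists>s\<in>S. z 0 \<noteq> z s} = Z \<inter> {z \<in> configurations \<Sigma>. \<exists>s\<in>S. z 0 \<noteq> z s}"
    using closedin_subset[OF assms(2)] by (auto simp: topspace_config_topology)
  moreover have "closedin (config_topology \<Sigma>) {z \<in> configurations \<Sigma>. \<exists>s\<in>S. z 0 \<noteq> z s}"
    by (rule closedin_finitely_determined[of "insert 0 S"]) (use assms(3) in \<open>auto simp: agree_def\<close>)
  ultimately show "closedin (config_topology \<Sigma>) {z \<in> Z. \<exists>s\<in>S. z 0 \<noteq> z s}"
    using assms(2) by auto
qed (use assms(4) in auto)

text \<open>
  Finitely many configurations of \<open>Z\<close> violate the period \<open>(N, 0)\<close> or \<open>(0, N)\<close> of the derivative at the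
  origin, and countability of \<open>X\<close> gives each of them a period. Every other member of \<open>Z\<close> either
  satisfies both periods everywhere or is a translate of one of these. So the normalised periods of
  these finitely many configurations serve for all members of \<open>Z\<close> that violate one of the normalised
  periods, as local periodicity requires.
\<close>

lemma locally_like_rank_two_subshift_periodic:
  fixes X :: "(int \<times> int \<Rightarrow> 'a) set"
  assumes "finite \<Sigma>" "is_SFT \<Sigma> X" "countable X"
    and Z: "closedin (config_topology \<Sigma>) Z" "shift_invariant Z" "Z \<subseteq> X"
    and F: "finite (top_derivative (config_topology \<Sigma>) Z)"
  shows "\<exists>S R. finite S \<and> (\<forall>s\<in>S. s \<noteq> 0) \<and>
    (\<forall>c. (\<forall>v. \<exists>z\<in>Z. agree (square R) (shift v c) z) \<longrightarrow> (\<exists>s\<in>S. shift s c = c))"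
proof -
  let ?F = "top_derivative (config_topology \<Sigma>) Z"
  have "Z \<subseteq> configurations \<Sigma>" using Z(3) SFT_subset[OF assms(2)] by blast
  then have "shift_invariant ?F" by (rule shift_invariant_top_derivative[OF Z(2)])
  then obtain N where N: "N > 0" "\<And>f. f \<in> ?F \<Longrightarrow> shift (N, 0) f = f" "\<And>f. f \<in> ?F \<Longrightarrow> shift (0, N) f = f"
    using finite_shift_invariant_periodic[OF F] by blast
  have F_per: "f 0 = f s" if f: "f \<in> ?F" and s: "N dvd fst s" "N dvd snd s" for f s
  proof -
    have "shift s f = f" using N(2,3)[OF f] s by (rule shift_lattice)
    then show ?thesis by (metis add_0_right shift_apply)
  qed
  define K where "K = {z \<in> Z. \<exists>s\<in>{(N, 0), (0, N)}. z 0 \<noteq> z s}"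
  have K: "finite K"
    unfolding K_def by (rule finite_defects[OF assms(1) Z(1)]) (use F_per in auto)
  have stab: "\<forall>x\<in>K. \<exists>w. w \<noteq> 0 \<and> shift w x = x"
  proof (rule ballI, rule ccontr)
    fix x assume x: "x \<in> K" and contra: "\<not> (\<exists>w. w \<noteq> 0 \<and> shift w x = x)"
    let ?B = "{v. x v \<noteq> x (v + (N, 0)) \<or> x v \<noteq> x (v + (0, N))}"
    \<comment> \<open>Without periods all translates of x are distinct, so distinct defects of x give distinct
      members of the finite set K.\<close>
    have "inj (\<lambda>v. shift v x)"
    proof (rule injI)
      fix u v assume "shift u x = shift v x"
      then have "shift (- u) (shift u x) = shift (- u) (shift v x)" by simp
      then have "shift (v - u) x = x" by (simp add: shift_shift)
      with contra show "u = v" by (metis eq_iff_diff_eq_0)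
    qed
    moreover have "(\<lambda>v. shift v x) ` ?B \<subseteq> K"
      using x shift_invariantD[OF Z(2)] by (auto simp: K_def shift_apply)
    ultimately have "finite ?B"
      using finite_imageD[of "\<lambda>v. shift v x" ?B] finite_subset[OF _ K] inj_on_subset[OF _ subset_UNIV] by blast
    moreover have "0 \<in> ?B" using x by (auto simp: K_def)
    moreover have "x \<in> X" using x Z(3) by (auto simp: K_def)
    ultimately have "uncountable X"
      using uncountable_if_finite_perturbation[OF assms(2) _ N(1), of x] by blast
    with assms(3) show False by blast
  qed
  obtain S where S: "finite S" "S \<noteq> {}" "\<forall>s\<in>S. s \<noteq> 0 \<and> N dvd fst s \<and> N dvd snd s"
    "\<forall>s\<in>S. \<forall>s'\<in>S. fst s * snd s' = snd s * fst s' \<longrightarrow> s = s'"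
    "\<forall>x\<in>K. \<exists>s\<in>S. shift s x = x"
    using normalised_stabiliser_vectors[OF K N(1) stab] by (elim exE conjE)
  have "\<exists>s\<in>S. shift s z = z" if z: "z \<in> Z" "\<exists>s\<in>S. z 0 \<noteq> z s" for z
  proof -
    have "\<exists>v. z v \<noteq> z (v + (N, 0)) \<or> z v \<noteq> z (v + (0, N))"
    proof (rule ccontr)
      assume "\<not> ?thesis"
      then have "z (v + (N, 0)) = z v" "z (v + (0, N)) = z v" for v by metis+
      then have "shift (N, 0) z = z" "shift (0, N) z = z"
        unfolding shift_def fun_eq_iff by (metis add.commute)+
      then have "z 0 = z s" if "s \<in> S" for s
        using shift_lattice[of N z s] S(3) that by (metis add_0_right shift_apply)
      with z(2) show False by blast
    qed
    then obtain v where "z v \<noteq> z (v + (N, 0)) \<or> z v \<noteq> z (v + (0, N))" by blast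
    then have "shift v z \<in> K"
      using z(1) shift_invariantD[OF Z(2)] by (auto simp: K_def shift_apply)
    then obtain s where s: "s \<in> S" "shift s (shift v z) = shift v z" using S(5) by blast
    then have "shift (- v) (shift s (shift v z)) = shift (- v) (shift v z)" by simp
    then have "shift s z = z" by (simp add: shift_shift)
    with s(1) show ?thesis by blast
  qed
  then have "\<exists>R. \<forall>c. (\<forall>v. \<exists>z\<in>Z. agree (square R) (shift v c) z) \<longrightarrow> (\<exists>s\<in>S. shift s c = c)"
    using F_per S by (intro local_periodicity[OF Z(2) S(1,2)] finite_defects[OF assms(1) Z(1) S(1)]) blast+
  with S(1,3) show ?thesis by blast
qed

section \<open>The rank of a countable subshift of finite type\<close>

theorem theorem5p3:
  fixes r :: "'o rel" and lam :: 'o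
  assumes "Well_order r" and "wo_rel.isLimOrd r"
    and "lam \<in> Field r" and "wo_rel.isLim r lam" and "lam \<noteq> wo_rel.zero r"
  shows "\<not> (\<exists>(\<Sigma> :: 'a set) X. finite \<Sigma> \<and> is_SFT \<Sigma> X \<and> countable X \<and>
           has_cb_rank r (config_topology \<Sigma>) X (wo_rel.succ r (wo_rel.succ r lam)))"
proof
  interpret wo_rel r by (rule wo_rel.intro) fact
  assume "\<exists>(\<Sigma> :: 'a set) X. finite \<Sigma> \<and> is_SFT \<Sigma> X \<and> countable X \<and>
           has_cb_rank r (config_topology \<Sigma>) X (succ (succ lam))"
  then obtain \<Sigma> :: "'a set" and X where fin: "finite \<Sigma>" and sft: "is_SFT \<Sigma> X" and count: "countable X"
    and rank: "has_cb_rank r (config_topology \<Sigma>) X (succ (succ lam))" by blast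
  let ?T = "config_topology \<Sigma>"
  let ?D = "cb_derivative r ?T X"
  have next_lam: "succ lam \<in> Field r" "succ (succ lam) \<in> Field r"
    using assms(2,3) by (simp_all add: isLimOrd_succ)
  have above: "aboveS \<beta> \<noteq> {}" if "\<beta> \<in> Field r" for \<beta>
    using isLimOrd_aboveS[OF assms(2) that] .
  \<comment> \<open>A nonzero limit has smaller elements, so the family of earlier derivatives is nonempty.\<close>
  have zero: "zero \<in> underS lam" using assms(3,5) by (intro underS_I) auto
  have D: "closedin ?T (?D \<beta>)" "shift_invariant (?D \<beta>)" "?D \<beta> \<subseteq> X" if "\<beta> \<in> Field r" for \<beta>
  proof -
    show "closedin ?T (?D \<beta>)" "shift_invariant (?D \<beta>)"
      using cb_derivative_properties[OF assms(1) SFT_closed[OF sft] SFT_shift_invariant[OF sft] that] by auto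
    have "(zero, \<beta>) \<in> r" using that by simp
    from cb_derivative_antimono[OF assms(1) this, of ?T X] show "?D \<beta> \<subseteq> X"
      unfolding cb_derivative_zero[OF assms(1)] .
  qed
  have D_succ: "?D (succ \<beta>) = top_derivative ?T (?D \<beta>)" if "\<beta> \<in> Field r" for \<beta>
    using cb_derivative_succ[OF assms(1) above[OF that]] .
  have "?D (succ (succ lam)) = {}"
  proof (rule countable_perfect_imp_empty[OF fin D(1)])
    show "top_derivative ?T (?D (succ (succ lam))) = ?D (succ (succ lam))"
      using rank D_succ[OF next_lam(2)] by (simp add: has_cb_rank_def isMinim_def)
  qed (use next_lam D(3) count countable_subset in blast)+
  then have "finite (?D (succ lam))"
    using D_succ[OF next_lam(1)] by (intro finite_if_no_accumulation[OF fin D(1)[OF next_lam(1)] subset_refl]) simp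
  then have "finite (top_derivative ?T (?D lam))" by (simp add: D_succ[OF assms(3)])
  then obtain S R where S: "finite S" "\<And>s. s \<in> S \<Longrightarrow> s \<noteq> 0"
    and R: "\<And>c. (\<forall>v. \<exists>z\<in>?D lam. agree (square R) (shift v c) z) \<Longrightarrow> \<exists>s\<in>S. shift s c = c"
    using locally_like_rank_two_subshift_periodic[OF fin sft count D[OF assms(3)]] by blast
  have lim: "?D lam = (\<Inter>\<alpha>\<in>underS lam. ?D \<alpha>)"
    using cb_derivative_lim[OF assms(1,4,5)] .
  have "\<exists>\<alpha>\<in>underS lam. \<forall>c\<in>?D \<alpha>. \<exists>z\<in>\<Inter>\<alpha>\<in>underS lam. ?D \<alpha>. agree (square R) c z"
  proof (rule chain_locally_like_intersection[OF fin])
    fix \<alpha> \<beta> assume "\<alpha> \<in> underS lam" "\<beta> \<in> underS lam"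
    then have in_Field: "\<alpha> \<in> Field r" "\<beta> \<in> Field r" by (auto simp: underS_def Field_def)
    show "closedin ?T (?D \<alpha>)" using D(1)[OF in_Field(1)] .
    show "?D \<alpha> \<subseteq> ?D \<beta> \<or> ?D \<beta> \<subseteq> ?D \<alpha>"
    proof -
      have "(\<alpha>, \<beta>) \<in> r \<or> (\<beta>, \<alpha>) \<in> r" using TOTALS in_Field by blast
      then show ?thesis
        using cb_derivative_antimono[OF assms(1), of _ _ ?T X] by blast
    qed
  qed (use zero in auto)
  then obtain \<alpha> where \<alpha>: "\<alpha> \<in> underS lam" "\<And>c. c \<in> ?D \<alpha> \<Longrightarrow> \<exists>z\<in>?D lam. agree (square R) c z"
    unfolding lim by blast
  have \<alpha>_Field: "\<alpha> \<in> Field r" using \<alpha>(1) by (auto simp: underS_def Field_def)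
  have sub: "?D \<alpha> \<subseteq> (\<Union>s\<in>S. {c \<in> X. shift s c = c})"
  proof
    fix c assume c: "c \<in> ?D \<alpha>"
    then have "shift v c \<in> ?D \<alpha>" for v using D(2)[OF \<alpha>_Field] by (rule shift_invariantD[rotated])
    then have "\<exists>s\<in>S. shift s c = c" using \<alpha>(2) by (intro R) blast
    then show "c \<in> (\<Union>s\<in>S. {c \<in> X. shift s c = c})" using c D(3)[OF \<alpha>_Field] by blast
  qed
  have "\<exists>n. \<forall>s\<in>S. (top_derivative ?T ^^ n) {c \<in> X. shift s c = c} = {}"
  proof -
    have "\<forall>s\<in>S. \<exists>n. (top_derivative ?T ^^ n) {c \<in> X. shift s c = c} = {}"
      using periodic_configurations_finite_rank[OF fin sft count] S(2) by blast
    from bchoice[OF this] obtain n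
      where n: "\<And>s. s \<in> S \<Longrightarrow> (top_derivative ?T ^^ n s) {c \<in> X. shift s c = c} = {}" by blast
    have "n s \<le> (\<Sum>s\<in>S. n s)" if "s \<in> S" for s using S(1) that by (intro member_le_sum) auto
    from iterated_top_derivative_antimono[OF this, of _ ?T]
    have "(top_derivative ?T ^^ (\<Sum>s\<in>S. n s)) {c \<in> X. shift s c = c} \<subseteq> {}" if "s \<in> S" for s
      unfolding n[OF that, symmetric] using that .
    then show ?thesis by (intro exI[of _ "\<Sum>s\<in>S. n s"]) simp
  qed
  then obtain n where n: "\<And>s. s \<in> S \<Longrightarrow> (top_derivative ?T ^^ n) {c \<in> X. shift s c = c} = {}" by blast
  have "?D lam \<subseteq> (top_derivative ?T ^^ n) (?D \<alpha>)"
    by (rule cb_derivative_lim_subset_iterate[OF assms(1,4) \<alpha>(1)])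
  also have "\<dots> \<subseteq> (top_derivative ?T ^^ n) (\<Union>s\<in>S. {c \<in> X. shift s c = c})"
    by (rule iterated_top_derivative_mono[OF sub])
  also have "\<dots> \<subseteq> (\<Union>s\<in>S. (top_derivative ?T ^^ n) {c \<in> X. shift s c = c})"
    using S(1) by (rule iterated_top_derivative_Union) (rule periodic_closed[OF SFT_closed[OF sft]])
  also have "\<dots> = {}" using n by blast
  finally have "?D lam = {}" by simp
  then have "?D lam = ?D (succ lam)"
    using top_derivative_subset[of ?T "{}"] by (simp add: D_succ[OF assms(3)])
  then have "(succ (succ lam), lam) \<in> r"
    using rank assms(3) by (simp add: has_cb_rank_def isMinim_def)
  then have "(succ lam, lam) \<in> r"
    using succ_in[OF above[OF next_lam(1)]] TRANS by (meson transD)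
  with succ_not_in[OF above[OF assms(3)]] show False by blast
qed

end
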